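(* Let $(V,E,\mu)$ be an infinite, connected, locally finite weighted graph which is not $p$-parabolic. Let $1<p<\infty$, $q>p-1$, and $\sigma:V\to(0,\infty)$. Put $\nu=\sigma\mu$, i.e. $\nu(x)=\sigma(x)\mu(x)$ for $x\in V$. Assume that there exists a $p$-adapted edge length $\rho$, i.e. a positive symmetric function $\rho:E\to(0,\infty)$ with $$\sum_{y\sim x}\mu_{xy}\,\rho(x,y)^p\le \nu(x)\qquad\text{for every }x\in V,$$ and assume that the metric space $(V,d_\rho)$ is complete. If, for some $o\in V$, $$\int_1^\infty \frac{r^{\frac{pq}{p-1}-1}}{\nu(B_\rho(o,r))^{\frac{q-p+1}{p-1}}}\,dr=\infty,$$ then every nonnegative solution $u:V\to[0,\infty)$ of $$-\Delta_p u(x)\ge \sigma(x)u(x)^q\qquad\text{for all }x\in V$$ is identically zero.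
   Context: Weighted graph: $V$ is the vertex set, $E$ the edge set; edge weights satisfy $\mu_{xy}=\mu_{yx}>0$ if $x\sim y$ (i.e. $\{x,y\}\in E$), and the vertex measure is $\mu(x)=\sum_{y\sim x}\mu_{xy}$. Write $\Phi_p(t)=|t|^{p-2}t$ (with $\Phi_p(0)=0$). The normalized $p$-Laplacian is $$\Delta_p u(x)=\frac1{\mu(x)}\sum_{y\sim x}\mu_{xy}\Phi_p(u(y)-u(x)).$$ For $A\subset V$, $\nu(A)=\sum_{x\in A}\nu(x)$. The path metric induced by $\rho$ is, for $x\ne y$, $d_\rho(x,y)=\inf\{\sum_{i=1}^m\rho(x_{i-1},x_i): x=x_0\sim x_1\sim\cdots\sim x_m=y\}$ (and $d_\rho(x,x)=0$), and $B_\rho(o,r)=\{x\in V: d_\rho(o,x)\le r\}$. Completeness of $(V,d_\rho)$ is equivalent (discrete Hopf–Rinow for locally finite graphs) to all $d_\rho$-balls being finite. For a finite nonempty $A\subset V$, $\operatorname{cap}_p(A)=\inf\{\sum_{\{x,y\}\in E}\mu_{xy}|v(x)-v(y)|^p : v \text{ finitely supported on }V,\ v\ge 1\text{ on }A\}$. The graph is called $p$-parabolic if $\operatorname{cap}_p(A)=0$ for every finite nonempty $A\subset V$. *)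

theory Defs
  imports "HOL-Analysis.Analysis"
begin

text \<open>The vertex set \<open>V\<close> is the whole type \<^typ>\<open>'v\<close>. The edge set consists of unordered pairs, and
  \<open>x ~ y\<close> is \<open>{x, y} \<in> E\<close>. Loops are not excluded. They contribute nothing to the \<open>p\<close>-Laplacian or to
  the capacity. The values of \<open>mu\<close> and \<open>rho\<close> off the edges are unconstrained and never used.\<close>

locale weighted_graph =
  fixes E :: "'v set set" and mu :: "'v \<Rightarrow> 'v \<Rightarrow> real"
  assumes edge_pair: "e \<in> E \<Longrightarrow> \<exists>x y. e = {x, y}"
    and mu_sym: "{x, y} \<in> E \<Longrightarrow> mu x y = mu y x"
    and mu_pos: "{x, y} \<in> E \<Longrightarrow> mu x y > 0"

definition nbrs :: "'v set set \<Rightarrow> 'v \<Rightarrow> 'v set" where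
  "nbrs E x = {y. {x, y} \<in> E}"

definition locally_finite_graph :: "'v set set \<Rightarrow> bool" where
  "locally_finite_graph E \<longleftrightarrow> (\<forall>x. finite (nbrs E x))"

definition connected_graph :: "'v set set \<Rightarrow> bool" where
  "connected_graph E \<longleftrightarrow> (\<forall>x y. (x, y) \<in> {(a, b). {a, b} \<in> E}\<^sup>*)"

definition vertex_measure :: "'v set set \<Rightarrow> ('v \<Rightarrow> 'v \<Rightarrow> real) \<Rightarrow> 'v \<Rightarrow> real" where
  "vertex_measure E mu x = (\<Sum>y\<in>nbrs E x. mu x y)"

text \<open>At \<open>t = 0\<close> the value is \<open>0\<close>, also for \<open>p < 2\<close>, since \<open>0 powr a = 0\<close>.\<close>

definition Phi :: "real \<Rightarrow> real \<Rightarrow> real" where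
  "Phi p t = \<bar>t\<bar> powr (p - 2) * t"

definition p_Laplacian ::
    "'v set set \<Rightarrow> ('v \<Rightarrow> 'v \<Rightarrow> real) \<Rightarrow> real \<Rightarrow> ('v \<Rightarrow> real) \<Rightarrow> 'v \<Rightarrow> real" where
  "p_Laplacian E mu p u x =
     1 / vertex_measure E mu x * (\<Sum>y\<in>nbrs E x. mu x y * Phi p (u y - u x))"

text \<open>The sum over unordered edges is half the sum over ordered pairs, since the summand is symmetric
  and vanishes on loops. For finitely supported \<open>v\<close> on a locally finite graph, only finitely many
  terms are nonzero.\<close>

definition p_energy ::
    "'v set set \<Rightarrow> ('v \<Rightarrow> 'v \<Rightarrow> real) \<Rightarrow> real \<Rightarrow> ('v \<Rightarrow> real) \<Rightarrow> real" where
  "p_energy E mu p v =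
     (1 / 2) * (\<Sum>\<^sub>\<infinity>(x, y) \<in> {(x, y). {x, y} \<in> E}. mu x y * \<bar>v x - v y\<bar> powr p)"

definition p_capacity ::
    "'v set set \<Rightarrow> ('v \<Rightarrow> 'v \<Rightarrow> real) \<Rightarrow> real \<Rightarrow> 'v set \<Rightarrow> real" where
  "p_capacity E mu p A =
     Inf {p_energy E mu p v | v. finite {x. v x \<noteq> 0} \<and> (\<forall>x\<in>A. v x \<ge> 1)}"

definition p_parabolic :: "'v set set \<Rightarrow> ('v \<Rightarrow> 'v \<Rightarrow> real) \<Rightarrow> real \<Rightarrow> bool" where
  "p_parabolic E mu p \<longleftrightarrow> (\<forall>A. finite A \<and> A \<noteq> {} \<longrightarrow> p_capacity E mu p A = 0)"

definition edge_length :: "'v set set \<Rightarrow> ('v \<Rightarrow> 'v \<Rightarrow> real) \<Rightarrow> bool" where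
  "edge_length E rho \<longleftrightarrow> (\<forall>x y. {x, y} \<in> E \<longrightarrow> rho x y > 0 \<and> rho x y = rho y x)"

definition p_adapted ::
    "'v set set \<Rightarrow> ('v \<Rightarrow> 'v \<Rightarrow> real) \<Rightarrow> real \<Rightarrow> ('v \<Rightarrow> real) \<Rightarrow> ('v \<Rightarrow> 'v \<Rightarrow> real) \<Rightarrow> bool" where
  "p_adapted E mu p nu rho \<longleftrightarrow>
     edge_length E rho \<and> (\<forall>x. (\<Sum>y\<in>nbrs E x. mu x y * rho x y powr p) \<le> nu x)"

definition path_lengths ::
    "'v set set \<Rightarrow> ('v \<Rightarrow> 'v \<Rightarrow> real) \<Rightarrow> 'v \<Rightarrow> 'v \<Rightarrow> real set" where
  "path_lengths E rho x y =
     {\<Sum>i=1..m. rho (f (i - 1)) (f i) | (m::nat) f.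
        f 0 = x \<and> f m = y \<and> (\<forall>i\<in>{1..m}. {f (i - 1), f i} \<in> E)}"

definition path_dist ::
    "'v set set \<Rightarrow> ('v \<Rightarrow> 'v \<Rightarrow> real) \<Rightarrow> 'v \<Rightarrow> 'v \<Rightarrow> real" where
  "path_dist E rho x y = (if x = y then 0 else Inf (path_lengths E rho x y))"

definition path_ball ::
    "'v set set \<Rightarrow> ('v \<Rightarrow> 'v \<Rightarrow> real) \<Rightarrow> 'v \<Rightarrow> real \<Rightarrow> 'v set" where
  "path_ball E rho x0 r = {x. path_dist E rho x0 x \<le> r}"

text \<open>For a nonnegative \<open>nu\<close> with infinite total mass on \<open>A\<close>, \<^const>\<open>infsum\<close> returns \<open>0\<close>, and
  the integrand \<open>a / set_mass nu A powr b\<close> is then \<open>0\<close>, as it should be. In the theorem this does not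
  occur, because completeness makes all balls finite.\<close>

definition set_mass :: "('v \<Rightarrow> real) \<Rightarrow> 'v set \<Rightarrow> real" where
  "set_mass nu A = infsum nu A"

text \<open>On a locally finite connected graph the path distance is a metric, so \<^const>\<open>Metric_space.mcomplete\<close>
  applied to it has its intended meaning.\<close>

lemma path_lengths_nonempty:
  assumes "connected_graph E"
  shows "path_lengths E rho x y \<noteq> {}"
proof -
  have "(x, y) \<in> {(a, b). {a, b} \<in> E}\<^sup>*"
    using assms unfolding connected_graph_def by blast
  then obtain n where "(x, y) \<in> {(a, b). {a, b} \<in> E} ^^ n"
    using rtrancl_power by blast
  then obtain f where f: "f 0 = x" "f n = y" "\<forall>i<n. (f i, f (Suc i)) \<in> {(a, b). {a, b} \<in> E}"
    by (auto simp: relpow_fun_conv)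
  have "{f (i - 1), f i} \<in> E" if "i \<in> {1..n}" for i
    using f(3)[rule_format, of "i - 1"] that by auto
  with f show ?thesis
    unfolding path_lengths_def by blast
qed

lemma path_lengths_nonneg:
  assumes "edge_length E rho" "s \<in> path_lengths E rho x y"
  shows "0 \<le> s"
proof -
  obtain m :: nat and f where f: "s = (\<Sum>i=1..m. rho (f (i - 1)) (f i))"
      "\<forall>i\<in>{1..m}. {f (i - 1), f i} \<in> E"
    using assms(2) unfolding path_lengths_def by blast
  show ?thesis
    unfolding f(1) using f(2) assms(1) unfolding edge_length_def
    by (intro sum_nonneg less_imp_le) blast
qed

lemma path_lengths_bdd_below:
  assumes "edge_length E rho"
  shows "bdd_below (path_lengths E rho x y)"
  using path_lengths_nonneg[OF assms] by (rule bdd_belowI)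

lemma path_lengths_sym:
  assumes "edge_length E rho" "s \<in> path_lengths E rho x y"
  shows "s \<in> path_lengths E rho y x"
proof -
  obtain m :: nat and f where f: "s = (\<Sum>i=1..m. rho (f (i - 1)) (f i))" "f 0 = x" "f m = y"
      "\<forall>i\<in>{1..m}. {f (i - 1), f i} \<in> E"
    using assms(2) unfolding path_lengths_def by blast
  define g where "g i = f (m - i)" for i
  have edge: "{g (i - 1), g i} \<in> E" if "i \<in> {1..m}" for i
  proof -
    have "Suc m - i \<in> {1..m}" "Suc m - i - 1 = m - i" "m - (i - 1) = Suc m - i"
      using that by auto
    then show ?thesis using f(4)[rule_format, of "Suc m - i"] unfolding g_def
      by (metis insert_commute)
  qed
  have "(\<Sum>i=1..m. rho (g (i - 1)) (g i)) = (\<Sum>i=1..m. rho (f (i - 1)) (f i))"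
  proof (rule sum.reindex_bij_witness[where i = "\<lambda>i. Suc m - i" and j = "\<lambda>i. Suc m - i"])
    fix i assume i: "i \<in> {1..m}"
    have eq: "Suc m - i - 1 = m - i" "m - (i - 1) = Suc m - i"
      using i by auto
    show "rho (f (Suc m - i - 1)) (f (Suc m - i)) = rho (g (i - 1)) (g i)"
      using edge[OF i] assms(1) unfolding edge_length_def g_def eq by metis
  qed auto
  moreover have "g 0 = y" "g m = x"
    using f by (auto simp: g_def)
  ultimately show ?thesis
    unfolding f(1) path_lengths_def mem_Collect_eq
    using edge by (intro exI[of _ m] exI[of _ g] conjI ballI) simp_all
qed

lemma path_lengths_append:
  assumes "s \<in> path_lengths E rho x y" "t \<in> path_lengths E rho y z"
  shows "s + t \<in> path_lengths E rho x z"
proof -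
  obtain m :: nat and f where f: "s = (\<Sum>i=1..m. rho (f (i - 1)) (f i))" "f 0 = x" "f m = y"
      "\<forall>i\<in>{1..m}. {f (i - 1), f i} \<in> E"
    using assms(1) unfolding path_lengths_def by blast
  obtain n :: nat and g where g: "t = (\<Sum>i=1..n. rho (g (i - 1)) (g i))" "g 0 = y" "g n = z"
      "\<forall>i\<in>{1..n}. {g (i - 1), g i} \<in> E"
    using assms(2) unfolding path_lengths_def by blast
  define h where "h i = (if i \<le> m then f i else g (i - m))" for i
  have h1: "h i = f i" if "i \<le> m" for i
    using that by (simp add: h_def)
  have h2: "h (m + i) = g i" for i
    using f(3) g(2) by (simp add: h_def)
  have edge: "{h (i - 1), h i} \<in> E" if "i \<in> {1..m + n}" for i
  proof (cases "i \<le> m")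
    case True
    then show ?thesis using that f(4) by (simp add: h1)
  next
    case False
    define j where "j = i - m"
    have j: "i = m + j" "j \<in> {1..n}"
      using that False by (auto simp: j_def)
    then have eq: "i - 1 = m + (j - 1)" by auto
    show ?thesis using g(4)[rule_format, OF j(2)] unfolding eq unfolding j(1) h2 .
  qed
  have "(\<Sum>i=1..m + n. rho (h (i - 1)) (h i))
      = (\<Sum>i=1..m. rho (h (i - 1)) (h i)) + (\<Sum>i=m + 1..m + n. rho (h (i - 1)) (h i))"
    by (rule sum.ub_add_nat) simp
  also have "(\<Sum>i=1..m. rho (h (i - 1)) (h i)) = s"
    unfolding f(1) by (rule sum.cong) (auto simp: h1)
  also have "(\<Sum>i=m + 1..m + n. rho (h (i - 1)) (h i)) = (\<Sum>i=1..n. rho (h (m + i - 1)) (h (m + i)))"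
    by (rule sum.reindex_bij_witness[where i = "\<lambda>i. m + i" and j = "\<lambda>i. i - m"]) auto
  also have "\<dots> = t"
    unfolding g(1)
  proof (rule sum.cong)
    fix i assume "i \<in> {1..n}"
    then have "m + i - 1 = m + (i - 1)" by auto
    then show "rho (h (m + i - 1)) (h (m + i)) = rho (g (i - 1)) (g i)"
      by (simp only: h2)
  qed simp
  finally have "s + t = (\<Sum>i=1..m + n. rho (h (i - 1)) (h i))" by simp
  moreover have "h 0 = x" "h (m + n) = z"
    using f g by (auto simp: h1 h2)
  ultimately show ?thesis
    unfolding path_lengths_def mem_Collect_eq
    using edge by (intro exI[of _ "m + n"] exI[of _ h] conjI ballI)
qed

lemma path_dist_pos:
  assumes "locally_finite_graph E" "connected_graph E" "edge_length E rho" "x \<noteq> y"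
  shows "0 < path_dist E rho x y"
proof -
  have ge: "\<exists>w\<in>nbrs E x. rho x w \<le> s" if s: "s \<in> path_lengths E rho x y" for s
  proof -
    obtain m :: nat and f where f: "s = (\<Sum>i=1..m. rho (f (i - 1)) (f i))" "f 0 = x" "f m = y"
        "\<forall>i\<in>{1..m}. {f (i - 1), f i} \<in> E"
      using s unfolding path_lengths_def by blast
    have m: "1 \<le> m"
      using f assms(4) by (cases m) auto
    have "(\<Sum>i\<in>{1}. rho (f (i - 1)) (f i)) \<le> s"
      unfolding f(1)
    proof (rule sum_mono2)
      show "0 \<le> rho (f (i - 1)) (f i)" if "i \<in> {1..m} - {1}" for i
        using that f(4) assms(3) unfolding edge_length_def by (intro less_imp_le) blast
    qed (use m in auto)
    moreover have "f 1 \<in> nbrs E x"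
      using f m unfolding nbrs_def by force
    ultimately show ?thesis using f(2) by auto
  qed
  have fin: "finite (nbrs E x)"
    using assms(1) unfolding locally_finite_graph_def by blast
  have ne: "path_lengths E rho x y \<noteq> {}"
    using path_lengths_nonempty[OF assms(2)] .
  then have ne': "nbrs E x \<noteq> {}"
    using ge by blast
  let ?d = "Min (rho x ` nbrs E x)"
  have pos: "0 < rho x w" if "w \<in> nbrs E x" for w
    using that assms(3) unfolding edge_length_def nbrs_def by blast
  have "?d \<in> rho x ` nbrs E x"
    using fin ne' by (intro Min_in) auto
  then have "0 < ?d"
    using pos by (metis imageE)
  also have "?d \<le> Inf (path_lengths E rho x y)"
  proof (rule cInf_greatest[OF ne])
    fix s assume "s \<in> path_lengths E rho x y"
    then obtain w where "w \<in> nbrs E x" "rho x w \<le> s"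
      using ge by blast
    moreover have "?d \<le> rho x w"
      using fin \<open>w \<in> nbrs E x\<close> by (intro Min_le) auto
    ultimately show "?d \<le> s" by linarith
  qed
  finally show ?thesis
    using assms(4) by (simp add: path_dist_def)
qed

lemma Metric_space_path_dist:
  assumes "locally_finite_graph E" "connected_graph E" "edge_length E rho"
  shows "Metric_space UNIV (path_dist E rho)"
proof
  note ne = path_lengths_nonempty[OF assms(2)]
  note bdd = path_lengths_bdd_below[OF assms(3)]
  have nonneg: "0 \<le> path_dist E rho x y" for x y
    using path_dist_pos[OF assms, of x y] by (cases "x = y") (auto simp: path_dist_def)
  then show "0 \<le> path_dist E rho x y" for x y .
  have "path_lengths E rho x y = path_lengths E rho y x" for x y
    using path_lengths_sym[OF assms(3)] by blast
  then show "path_dist E rho x y = path_dist E rho y x" for x y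
    by (simp add: path_dist_def)
  show "path_dist E rho x y = 0 \<longleftrightarrow> x = y" for x y
    using path_dist_pos[OF assms, of x y] by (auto simp: path_dist_def)
  show "path_dist E rho x z \<le> path_dist E rho x y + path_dist E rho y z" for x y z
  proof (cases "x = y \<or> y = z \<or> x = z")
    case True
    then show ?thesis using nonneg[of x y] nonneg[of y z] by (auto simp: path_dist_def)
  next
    case False
    have "Inf (path_lengths E rho x z) - Inf (path_lengths E rho y z) \<le> s"
      if s: "s \<in> path_lengths E rho x y" for s
    proof -
      have "Inf (path_lengths E rho x z) - s \<le> Inf (path_lengths E rho y z)"
      proof (rule cInf_greatest[OF ne])
        fix t assume "t \<in> path_lengths E rho y z"
        then have "Inf (path_lengths E rho x z) \<le> s + t"
          by (intro cInf_lower path_lengths_append[OF s] bdd)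
        then show "Inf (path_lengths E rho x z) - s \<le> t" by linarith
      qed
      then show ?thesis by linarith
    qed
    then have "Inf (path_lengths E rho x z) - Inf (path_lengths E rho y z)
        \<le> Inf (path_lengths E rho x y)"
      by (intro cInf_greatest[OF ne]) auto
    then show ?thesis using False by (simp add: path_dist_def)
  qed
qed

end

theory Submission
  imports Defs
begin

text \<open>By the strong minimum principle a nonnegative solution \<open>u\<close> is either zero or positive, so assume
  \<open>u > 0\<close>. Put \<open>m = q / (p - 1) > 1\<close>.

  The inequality is tested with \<open>\<phi>\<^sup>s (1 + M u\<^sup>-\<^sup>a)\<close>, where \<open>0 \<le> \<phi> \<le> 1\<close> is finitely supported, \<open>a > 0\<close> is small
  and \<open>s, M\<close> are large. The part with \<open>u\<^sup>-\<^sup>a\<close> is a Caccioppoli estimate, and it absorbs the gradient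
  of \<open>u\<close> that the other part leaves over. With \<open>w(x) = \<Sum> \<mu>\<^sub>x\<^sub>y (\<phi>(x) - \<phi>(y))\<^sup>p\<close>, summed over
  the neighbours \<open>y\<close> with \<open>\<phi>(y) < \<phi>(x)\<close>, this gives (\<open>cutoff_estimate\<close>)
  \<open>\<Sum> \<nu> u\<^sup>q \<phi>\<^sup>s \<le> C \<Sum> w (1 + u\<^sup>q \<phi>\<^sup>s)\<close>. Applied to \<open>u / T\<close> and optimised in \<open>T\<close>, it becomes
  the lower bound \<open>\<Sum> w u\<^sup>q \<phi>\<^sup>s \<ge> const (\<Sum> \<nu> u\<^sup>q \<phi>\<^sup>s)\<^sup>m (\<Sum> w)\<^sup>1\<^sup>-\<^sup>m\<close> (\<open>cutoff_growth\<close>).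

  Let \<open>\<phi>\<^sub>k\<close> be the cutoff, as a function of the distance to the centre, that falls linearly from
  \<open>1\<close> to \<open>0\<close> between the radii \<open>R\<^sub>k = 2\<^sup>k / 2\<close> and \<open>2\<^sup>k\<close>. The functions \<open>R\<^sub>k \<phi>\<^sub>k\<close> telescope, so along
  every edge their differences add up to at most the length of the edge. As \<open>\<rho>\<close> is
  \<open>p\<close>-adapted, this yields \<open>\<Sum>\<^sub>k R\<^sub>k\<^sup>p w\<^sub>k \<le> \<nu>\<close> (\<open>sum_descent_energy_cutoff_le\<close>), however long the edges
  are. Hence \<open>F\<^sub>k = \<Sum> \<nu> u\<^sup>q \<phi>\<^sub>k\<^sup>s\<close> and \<open>A\<^sub>k = \<Sum> R\<^sub>k\<^sup>p w\<^sub>k u\<^sup>q \<phi>\<^sub>k\<^sup>s\<close> satisfy \<open>A\<^sub>k \<le> F\<^sub>k\<close>,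
  \<open>\<Sum>\<^sub>j\<^sub><\<^sub>k A\<^sub>j \<le> F\<^sub>k\<close> and \<open>A\<^sub>k \<ge> const c\<^sub>k F\<^sub>k\<^sup>m\<close>, where \<open>c\<^sub>k = (2\<^sup>k)\<^sup>p\<^sup>m \<nu>(B(2\<^sup>k))\<^sup>1\<^sup>-\<^sup>m\<close>. These three relations
  force \<open>\<Sum> c\<^sub>k < \<infinity>\<close> (\<open>summable_of_superlinear_growth\<close>), a discrete version of the finite-time
  blow-up of \<open>F' = c F\<^sup>m\<close>. The series \<open>\<Sum> c\<^sub>k\<close> dominates the volume integral
  (\<open>dyadic_integral_finite\<close>), which is therefore finite, a contradiction.

  Completeness enters through the finiteness of balls (\<open>finite_path_ball\<close>), which makes the cutoffs
  finitely supported.\<close>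

section \<open>Elementary inequalities\<close>

lemma powr_ge_tangent:
  fixes x s :: real
  assumes "0 \<le> x" "1 \<le> s"
  shows "1 + s * (x - 1) \<le> x powr s"
proof (cases "x = 0")
  case False
  then have "(x powr s) powr (1 / s) * 1 powr (1 - 1 / s) \<le> 1 / s * x powr s + (1 - 1 / s) * 1"
    using assms by (intro Youngs_inequality_0) auto
  then have "x \<le> 1 / s * x powr s + (1 - 1 / s)"
    using assms by (simp add: powr_powr)
  then have "s * x \<le> s * (1 / s * x powr s + (1 - 1 / s))"
    using assms by (intro mult_left_mono) auto
  also have "\<dots> = x powr s + s - 1"
    using assms by (simp add: field_simps)
  finally show ?thesis by (simp add: algebra_simps)
qed (use assms in auto)

lemma powr_minus_ge_tangent:
  fixes x a :: real
  assumes "0 < x" "0 \<le> a"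
  shows "1 + a * (1 - x) \<le> x powr (- a)"
proof -
  have "a * ln x \<le> a * (x - 1)"
    using assms ln_le_minus_one[of x] by (intro mult_left_mono) auto
  then have "1 + a * (1 - x) \<le> 1 + (- a * ln x)"
    by (simp add: algebra_simps)
  also have "\<dots> \<le> x powr (- a)"
    using assms exp_ge_add_one_self[of "- a * ln x"] by (simp add: powr_def)
  finally show ?thesis .
qed

lemma powr_diff_one_mult_le:
  fixes X Y p :: real
  assumes "0 \<le> X" "0 \<le> Y" "1 < p"
  shows "X powr (p - 1) * Y \<le> X powr p + Y powr p"
proof (cases "Y \<le> X")
  case True
  then have "X powr (p - 1) * Y \<le> X powr (p - 1) * X" by (intro mult_left_mono) auto
  also have "\<dots> = X powr p" using assms by (cases "X = 0") (auto simp: powr_diff)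
  finally show ?thesis using powr_ge_zero[of Y p] by linarith
next
  case False
  then have "X powr (p - 1) * Y \<le> Y powr (p - 1) * Y"
    using assms by (intro mult_right_mono powr_mono2) auto
  also have "\<dots> = Y powr p" using assms False by (auto simp: powr_diff)
  finally show ?thesis using powr_ge_zero[of X p] by linarith
qed

text \<open>The pointwise Caccioppoli inequality in the relative decrements \<open>\<tau> = (U - V) / U\<close> and
  \<open>\<eta> = (f - g) / f\<close>.\<close>

lemma caccioppoli_normalised:
  fixes \<tau> \<eta> a s p :: real
  assumes \<tau>: "0 < \<tau>" "\<tau> < 1" and \<eta>: "0 \<le> \<eta>" "\<eta> \<le> 1"
    and a: "0 < a" and s: "1 \<le> s" and p: "1 < p"
  defines "K \<equiv> s * (1 + a)"
  shows "\<tau> powr (p - 1) * (1 - (1 - \<eta>) powr s * (1 - \<tau>) powr (- a))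
      \<le> K * (2 * K / a) powr (p - 1) * \<eta> powr p - a / 2 * \<tau> powr p"
proof -
  have K: "0 < K" using a s by (simp add: K_def)
  have "(1 - s * \<eta>) * (1 + a * \<tau>) \<le> (1 - \<eta>) powr s * (1 - \<tau>) powr (- a)"
  proof (cases "1 - s * \<eta> \<ge> 0")
    case True
    then show ?thesis
      using powr_ge_tangent[of "1 - \<eta>" s] powr_minus_ge_tangent[of "1 - \<tau>" a] assms
      by (intro mult_mono) (auto simp: algebra_simps)
  next
    case False
    then have "(1 - s * \<eta>) * (1 + a * \<tau>) \<le> 0"
      using a \<tau> by (intro mult_nonpos_nonneg) auto
    then show ?thesis by (smt (verit) powr_ge_zero mult_nonneg_nonneg)
  qed
  moreover have "s * a * (\<eta> * \<tau>) \<le> s * a * \<eta>"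
    using assms by (intro mult_left_mono mult_left_le) auto
  ultimately have "1 - (1 - \<eta>) powr s * (1 - \<tau>) powr (- a) \<le> K * \<eta> - a * \<tau>"
    by (simp add: K_def algebra_simps)
  then have "\<tau> powr (p - 1) * (1 - (1 - \<eta>) powr s * (1 - \<tau>) powr (- a))
      \<le> \<tau> powr (p - 1) * (K * \<eta> - a * \<tau>)"
    by (intro mult_left_mono) auto
  also have "\<dots> = \<tau> powr (p - 1) * (K * \<eta> - a / 2 * \<tau>) - a / 2 * \<tau> powr p"
    using \<tau> by (simp add: algebra_simps powr_diff)
  also have "\<tau> powr (p - 1) * (K * \<eta> - a / 2 * \<tau>) \<le> K * (2 * K / a) powr (p - 1) * \<eta> powr p"
  proof (cases "K * \<eta> \<le> a / 2 * \<tau>")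
    case True
    then have "\<tau> powr (p - 1) * (K * \<eta> - a / 2 * \<tau>) \<le> 0"
      by (intro mult_nonneg_nonpos) auto
    also have "0 \<le> K * (2 * K / a) powr (p - 1) * \<eta> powr p" using K by simp
    finally show ?thesis .
  next
    case False
    then have le: "\<tau> \<le> 2 * K / a * \<eta>" using a by (simp add: field_simps)
    have "\<tau> powr (p - 1) * (K * \<eta> - a / 2 * \<tau>) \<le> (2 * K / a * \<eta>) powr (p - 1) * (K * \<eta>)"
      using le \<tau> a K False p by (intro mult_mono powr_mono2) auto
    also have "\<dots> = K * (2 * K / a) powr (p - 1) * (\<eta> powr (p - 1) * \<eta>)"
      using a K \<eta> by (simp add: powr_mult powr_divide)
    also have "\<eta> powr (p - 1) * \<eta> = \<eta> powr p"
      using \<eta> p by (cases "\<eta> = 0") (auto simp: powr_diff)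
    finally show ?thesis .
  qed
  finally show ?thesis by simp
qed

text \<open>Here \<open>U > V\<close> are the values of \<open>u\<close> at the two ends of an edge, and \<open>f > g\<close> are those of the cutoff.
  The left-hand side is the contribution of the edge when the test function is \<open>\<phi>\<^sup>s u\<^sup>-\<^sup>a\<close>.\<close>

lemma caccioppoli_pointwise:
  fixes U V f g a s p :: real
  assumes UV: "0 < V" "V < U" and fg: "0 \<le> g" "g < f"
    and a: "0 < a" and s: "1 \<le> s" and p: "1 < p"
  defines "K \<equiv> s * (1 + a)"
  shows "(U - V) powr (p - 1) * (f powr s * U powr (- a) - g powr s * V powr (- a))
      \<le> K * (2 * K / a) powr (p - 1) * (U powr (p - 1 - a) * f powr (s - p) * (f - g) powr p)
        - a / 2 * ((U - V) powr p * U powr (- a - 1) * f powr s)"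
proof -
  define \<tau> \<eta> where "\<tau> = (U - V) / U" and "\<eta> = (f - g) / f"
  have \<tau>: "0 < \<tau>" "\<tau> < 1" and \<eta>: "0 \<le> \<eta>" "\<eta> \<le> 1"
    using UV fg by (auto simp: \<tau>_def \<eta>_def field_simps)
  have V: "V = U * (1 - \<tau>)" and D: "U - V = U * \<tau>" and g: "g = f * (1 - \<eta>)" and d: "f - g = f * \<eta>"
    using UV fg by (auto simp: \<tau>_def \<eta>_def field_simps)
  define c where "c = U powr (p - 1 - a) * f powr s"
  have c: "0 \<le> c" by (simp add: c_def)
  have U: "0 < U" and f: "0 < f" using UV fg by auto
  have e1: "(U - V) powr (p - 1) * (f powr s * U powr (- a) - g powr s * V powr (- a))
      = c * (\<tau> powr (p - 1) * (1 - (1 - \<eta>) powr s * (1 - \<tau>) powr (- a)))"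
  proof -
    have "(U - V) powr (p - 1) = U powr (p - 1) * \<tau> powr (p - 1)"
      using U \<tau> by (simp add: D powr_mult)
    moreover have "g powr s = f powr s * (1 - \<eta>) powr s"
      using f \<eta> by (simp only: g powr_mult)
    moreover have "V powr (- a) = U powr (- a) * (1 - \<tau>) powr (- a)"
      using U \<tau> by (simp only: V powr_mult)
    moreover have "c = U powr (p - 1) * U powr (- a) * f powr s"
      by (simp add: c_def powr_add[symmetric])
    ultimately show ?thesis by (simp only: right_diff_distrib mult_ac mult_1_right)
  qed
  have e2: "U powr (p - 1 - a) * f powr (s - p) * (f - g) powr p = c * \<eta> powr p"
    using U f \<eta> unfolding d c_def by (simp add: powr_mult powr_diff)
  have e3: "(U - V) powr p * U powr (- a - 1) * f powr s = c * \<tau> powr p"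
    using U f \<tau> unfolding D c_def by (simp add: powr_mult powr_diff powr_minus_divide mult_ac)
  have "c * (\<tau> powr (p - 1) * (1 - (1 - \<eta>) powr s * (1 - \<tau>) powr (- a)))
      \<le> c * (K * (2 * K / a) powr (p - 1) * \<eta> powr p - a / 2 * \<tau> powr p)"
    using caccioppoli_normalised[OF \<tau> \<eta> a s p] c unfolding K_def by (intro mult_left_mono)
  also have "\<dots> = K * (2 * K / a) powr (p - 1) * (c * \<eta> powr p) - a / 2 * (c * \<tau> powr p)"
    by (simp only: right_diff_distrib mult_ac)
  finally show ?thesis unfolding e1 e2 e3 .
qed

text \<open>The condition on \<open>s\<close> makes the powers of \<open>f\<close> that are lost to the gradient of the cutoff harmless.\<close>

lemma interpolation_pointwise:
  fixes U f b q s p :: real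
  assumes "0 < U" "0 < f" "f \<le> 1" "0 \<le> b" "b \<le> q" "0 < q" "q * p \<le> s * (q - b)"
  shows "U powr b * f powr (s - p) \<le> 1 + U powr q * f powr s"
proof -
  define X where "X = U powr q * f powr s"
  have X: "0 \<le> X" by (simp add: X_def)
  have e: "0 \<le> s - p - s * b / q" using assms by (simp add: field_simps)
  have "U powr b * f powr (s - p) = X powr (b / q) * f powr (s - p - s * b / q)"
    using assms by (simp add: X_def powr_mult powr_powr powr_add[symmetric] mult.assoc)
  also have "\<dots> \<le> X powr (b / q) * 1"
    using assms e by (intro mult_left_mono powr_le1) auto
  also have "X powr (b / q) \<le> 1 + X"
  proof (cases "X \<le> 1")
    case True
    then have "X powr (b / q) \<le> 1" using X assms by (intro powr_le1) auto
    then show ?thesis using X by simp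
  next
    case False
    then have "X powr (b / q) \<le> X powr 1" using assms by (intro powr_mono) auto
    then show ?thesis using False by simp
  qed
  finally show ?thesis by (simp add: X_def)
qed

text \<open>The constant \<open>M\<close> makes the negative term of the Caccioppoli inequality cancel the gradient of \<open>u\<close>
  produced by the test function \<open>\<phi>\<^sup>s\<close>.\<close>

lemma test_function_pointwise:
  fixes U V f g a s p q :: real
  assumes UV: "0 < V" "V < U" and fg: "0 \<le> g" "g < f" "f \<le> 1"
    and p: "1 < p" and a: "0 < a" "a \<le> p - 1" "(a + 1) * (p - 1) < q"
    and s: "1 \<le> s" "q * p \<le> s * (q - (a + 1) * (p - 1))"
  defines "K \<equiv> s * (1 + a)" and "M \<equiv> 2 * s / a"
  shows "(U - V) powr (p - 1) *
        (f powr s * (1 + M * U powr (- a)) - g powr s * (1 + M * V powr (- a)))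
      \<le> (M * K * (2 * K / a) powr (p - 1) + s) * ((f - g) powr p * (1 + U powr q * f powr s))"
proof -
  define D \<delta> where "D = U - V" and "\<delta> = f - g"
  have pos: "0 < U" "0 < D" "0 < f" "0 < \<delta>" using UV fg by (auto simp: D_def \<delta>_def)
  have q: "0 < q" using a p by (smt (verit) mult_pos_pos)
  define L where "L = K * (2 * K / a) powr (p - 1)"
  define Y where "Y = \<delta> powr p * (1 + U powr q * f powr s)"
  have M: "0 < M" using a s by (simp add: M_def)
  have L: "0 \<le> L" using a s by (simp add: L_def K_def)
  have Z: "0 < D powr p * U powr (- a - 1) * f powr s" using pos by simp
  have "f powr s - g powr s \<le> s * f powr (s - 1) * \<delta>"
  proof -
    have "f powr s * (1 + s * (g / f - 1)) \<le> f powr s * (g / f) powr s"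
      using powr_ge_tangent[of "g / f" s] fg s by (intro mult_left_mono) auto
    also have "\<dots> = g powr s" using fg by (simp add: powr_divide)
    finally show ?thesis using pos fg by (simp add: \<delta>_def powr_diff field_simps)
  qed
  then have "D powr (p - 1) * (f powr s - g powr s) \<le> D powr (p - 1) * (s * f powr (s - 1) * \<delta>)"
    by (intro mult_left_mono) auto
  \<comment> \<open>The powers of \<open>U\<close> in the two factors cancel. They are distributed so that the \<open>p\<close>-th power of the
    first factor is the negative term of the Caccioppoli inequality.\<close>
  also have "\<dots> = s * ((D * U powr (- (a + 1) / p) * f powr (s / p)) powr (p - 1)
        * (U powr ((a + 1) * (p - 1) / p) * f powr ((s - p) / p) * \<delta>))"
  proof -
    have "f powr (s - 1) = f powr (s / p * (p - 1) + (s - p) / p)"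
      using p by (intro arg_cong[where f = "\<lambda>x. f powr x"]) (simp add: field_simps)
    also have "\<dots> = f powr (s / p * (p - 1)) * f powr ((s - p) / p)" by (simp add: powr_add)
    finally have "f powr (s - 1) = f powr (s / p * (p - 1)) * f powr ((s - p) / p)" .
    moreover have "U powr (- (a + 1) / p * (p - 1)) * U powr ((a + 1) * (p - 1) / p) = 1"
      using pos p by (simp add: powr_add[symmetric] field_simps)
    ultimately show ?thesis
      using pos by (simp add: powr_mult powr_powr mult_ac)
  qed
  also have "\<dots> \<le> s * ((D * U powr (- (a + 1) / p) * f powr (s / p)) powr p
        + (U powr ((a + 1) * (p - 1) / p) * f powr ((s - p) / p) * \<delta>) powr p)"
    using s pos p by (intro mult_left_mono powr_diff_one_mult_le) auto
  also have "\<dots> = s * (D powr p * U powr (- a - 1) * f powr s)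
        + s * ((U powr ((a + 1) * (p - 1)) * f powr (s - p)) * \<delta> powr p)"
  proof -
    have "s / p * p = s" "(s - p) / p * p = s - p" "- (a + 1) / p * p = - a - 1"
      "(a + 1) * (p - 1) / p * p = (a + 1) * (p - 1)"
      using p by auto
    then show ?thesis
      using pos by (simp only: powr_mult powr_powr distrib_left mult.assoc)
  qed
  also have "(U powr ((a + 1) * (p - 1)) * f powr (s - p)) * \<delta> powr p
        \<le> (1 + U powr q * f powr s) * \<delta> powr p"
    using pos fg a s p q by (intro mult_right_mono interpolation_pointwise) auto
  finally have flux: "D powr (p - 1) * (f powr s - g powr s)
      \<le> s * (D powr p * U powr (- a - 1) * f powr s) + s * Y"
    using s by (simp add: Y_def mult_ac)
  have b: "p - 1 - a \<le> (a + 1) * (p - 1)" using a p by (simp add: algebra_simps)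
  then have "s * (q - (a + 1) * (p - 1)) \<le> s * (q - (p - 1 - a))"
    using s by (intro mult_left_mono) auto
  with s have "q * p \<le> s * (q - (p - 1 - a))" by linarith
  moreover have "0 \<le> p - 1 - a" "p - 1 - a \<le> q" using a b by linarith+
  ultimately have "U powr (p - 1 - a) * f powr (s - p) \<le> 1 + U powr q * f powr s"
    using pos fg q by (intro interpolation_pointwise)
  then have "U powr (p - 1 - a) * f powr (s - p) * \<delta> powr p \<le> Y"
    unfolding Y_def by (subst mult.commute) (intro mult_left_mono, auto)
  then have "L * (U powr (p - 1 - a) * f powr (s - p) * \<delta> powr p) \<le> L * Y"
    using L by (intro mult_left_mono)
  then have "D powr (p - 1) * (f powr s * U powr (- a) - g powr s * V powr (- a))
      \<le> L * Y - a / 2 * (D powr p * U powr (- a - 1) * f powr s)"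
    using caccioppoli_pointwise[OF UV fg(1,2) a(1) s(1) p] unfolding K_def[symmetric] L_def[symmetric]
      D_def[symmetric] \<delta>_def[symmetric] by linarith
  then have "M * (D powr (p - 1) * (f powr s * U powr (- a) - g powr s * V powr (- a)))
      \<le> M * (L * Y - a / 2 * (D powr p * U powr (- a - 1) * f powr s))"
    using M by (intro mult_left_mono) auto
  also have "\<dots> = M * L * Y - s * (D powr p * U powr (- a - 1) * f powr s)"
    using a by (simp add: M_def field_simps)
  finally have "M * (D powr (p - 1) * (f powr s * U powr (- a) - g powr s * V powr (- a)))
      + D powr (p - 1) * (f powr s - g powr s) \<le> M * L * Y + s * Y"
    using flux by linarith
  then show ?thesis
    unfolding Y_def L_def D_def[symmetric] \<delta>_def[symmetric] by (simp add: algebra_simps)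
qed

section \<open>Testing the inequality with a cutoff function\<close>

text \<open>The \<open>p\<close>-energy of \<open>\<phi>\<close> at \<open>x\<close>, counted only along the edges on which \<open>\<phi>\<close> decreases away
  from \<open>x\<close>. It vanishes off the support of a nonnegative \<open>\<phi>\<close>.\<close>

definition descent_energy ::
    "'v set set \<Rightarrow> ('v \<Rightarrow> 'v \<Rightarrow> real) \<Rightarrow> real \<Rightarrow> ('v \<Rightarrow> real) \<Rightarrow> 'v \<Rightarrow> real" where
  "descent_energy E mu p phi x =
     (\<Sum>y | {x, y} \<in> E \<and> phi y < phi x. mu x y * (phi x - phi y) powr p)"

lemma descent_energy_nonneg:
  assumes "weighted_graph E mu"
  shows "0 \<le> descent_energy E mu p phi x"
  unfolding descent_energy_def
  using weighted_graph.mu_pos[OF assms] by (intro sum_nonneg mult_nonneg_nonneg) (auto intro: less_imp_le)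

text \<open>A positive function \<open>u\<close> with \<open>- \<Delta>\<^sub>p u \<ge> \<sigma> u\<^sup>q\<close>, after multiplication by the vertex measure.\<close>

locale positive_supersolution = weighted_graph E mu
  for E :: "'v set set" and mu :: "'v \<Rightarrow> 'v \<Rightarrow> real" +
  fixes p q :: real and nu u :: "'v \<Rightarrow> real"
  assumes locally_finite: "locally_finite_graph E"
    and p: "1 < p"
    and nu_nonneg: "0 \<le> nu x"
    and u_pos: "0 < u x"
    and supersolution:
      "nu x * u x powr q \<le> (\<Sum>y\<in>nbrs E x. mu x y * Phi p (u x - u y))"
begin

lemma finite_nbrs: "finite (nbrs E x)"
  using locally_finite by (simp add: locally_finite_graph_def)

text \<open>The edges that meet \<open>S\<close>, oriented so that \<open>u\<close> decreases strictly along them. Edges on which \<open>u\<close> is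
  constant are left out.\<close>

definition descents :: "'v set \<Rightarrow> ('v \<times> 'v) set" where
  "descents S = {(x, y). {x, y} \<in> E \<and> u y < u x \<and> (x \<in> S \<or> y \<in> S)}"

lemma finite_descents:
  assumes "finite S"
  shows "finite (descents S)"
proof (rule finite_subset)
  show "descents S \<subseteq> Sigma S (nbrs E) \<union> prod.swap ` Sigma S (nbrs E)"
    by (auto simp: descents_def nbrs_def insert_commute image_iff Bex_def)
  show "finite (Sigma S (nbrs E) \<union> prod.swap ` Sigma S (nbrs E))"
    using assms finite_nbrs by auto
qed

text \<open>The weak form of the inequality, by summation by parts.\<close>

lemma weak_supersolution:
  assumes S: "finite S" and psi: "\<And>x. 0 \<le> psi x" "\<And>x. x \<notin> S \<Longrightarrow> psi x = 0"
  shows "(\<Sum>x\<in>S. nu x * u x powr q * psi x)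
    \<le> (\<Sum>(x, y)\<in>descents S. mu x y * ((u x - u y) powr (p - 1) * (psi x - psi y)))"
proof -
  define P where "P = {(x, y). {x, y} \<in> E \<and> (x \<in> S \<or> y \<in> S)}"
  define h where "h x y = mu x y * Phi p (u x - u y)" for x y
  define Z where "Z = {(x, y) \<in> P. u x = u y}"
  have P_eq: "P = descents S \<union> prod.swap ` descents S \<union> Z"
  proof (intro set_eqI iffI)
    fix e assume "e \<in> P"
    then obtain x y where e: "e = (x, y)" "{x, y} \<in> E" "x \<in> S \<or> y \<in> S" by (auto simp: P_def)
    consider "u y < u x" | "u x < u y" | "u x = u y" by linarith
    then show "e \<in> descents S \<union> prod.swap ` descents S \<union> Z"
    proof cases
      case 2
      then have "(y, x) \<in> descents S" using e by (auto simp: descents_def insert_commute)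
      then show ?thesis using e by (auto simp: image_iff Bex_def)
    qed (use e in \<open>auto simp: descents_def Z_def P_def\<close>)
  qed (auto simp: P_def Z_def descents_def insert_commute)
  have "P \<subseteq> Sigma S (nbrs E) \<union> prod.swap ` Sigma S (nbrs E)"
    by (auto simp: P_def nbrs_def insert_commute image_iff Bex_def)
  then have finP: "finite P"
    by (rule finite_subset) (use S finite_nbrs in auto)
  have fin: "finite (descents S)" "finite Z"
    using finite_subset[OF _ finP, of Z] finite_descents[OF S] by (simp_all add: Z_def Collect_case_prod_mono subset_iff)
  have "(\<Sum>x\<in>S. nu x * u x powr q * psi x) \<le> (\<Sum>x\<in>S. (\<Sum>y\<in>nbrs E x. h x y) * psi x)"
    using supersolution psi unfolding h_def by (intro sum_mono mult_right_mono) auto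
  also have "\<dots> = (\<Sum>(x, y)\<in>Sigma S (nbrs E). h x y * psi x)"
    using S finite_nbrs by (simp add: sum.Sigma[symmetric] sum_distrib_right)
  also have "\<dots> = (\<Sum>(x, y)\<in>P. h x y * psi x)"
  proof (rule sum.mono_neutral_left[OF finP])
    show "\<forall>e\<in>P - Sigma S (nbrs E). (case e of (x, y) \<Rightarrow> h x y * psi x) = 0"
    proof
      fix e assume e: "e \<in> P - Sigma S (nbrs E)"
      obtain x y where xy: "e = (x, y)" by fastforce
      with e have "x \<notin> S" by (auto simp: P_def nbrs_def)
      then show "(case e of (x, y) \<Rightarrow> h x y * psi x) = 0" using psi(2) xy by simp
    qed
    show "Sigma S (nbrs E) \<subseteq> P" by (auto simp: P_def nbrs_def)
  qed
  also have "\<dots> = (\<Sum>(x, y)\<in>descents S. h x y * psi x)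
      + (\<Sum>(x, y)\<in>prod.swap ` descents S. h x y * psi x) + (\<Sum>(x, y)\<in>Z. h x y * psi x)"
  proof -
    have "descents S \<inter> prod.swap ` descents S = {}"
      "(descents S \<union> prod.swap ` descents S) \<inter> Z = {}"
      by (auto simp: descents_def Z_def)
    then show ?thesis
      unfolding P_eq using fin by (simp add: sum.union_disjoint)
  qed
  also have "(\<Sum>(x, y)\<in>Z. h x y * psi x) = 0"
    by (rule sum.neutral) (auto simp: Z_def h_def Phi_def)
  also have "(\<Sum>(x, y)\<in>prod.swap ` descents S. h x y * psi x)
      = (\<Sum>(x, y)\<in>descents S. h y x * psi y)"
    by (subst sum.reindex) (auto simp: inj_on_def case_prod_unfold)
  also have "\<dots> = (\<Sum>(x, y)\<in>descents S. - (h x y * psi y))"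
  proof (intro sum.cong refl, clarify)
    fix x y assume "(x, y) \<in> descents S"
    then have "mu y x = mu x y" using mu_sym[of x y] by (simp add: descents_def)
    then show "h y x * psi y = - (h x y * psi y)"
      by (simp add: h_def Phi_def abs_minus_commute algebra_simps)
  qed
  also have "(\<Sum>(x, y)\<in>descents S. h x y * psi x) + (\<Sum>(x, y)\<in>descents S. - (h x y * psi y)) + 0
      = (\<Sum>(x, y)\<in>descents S. h x y * (psi x - psi y))"
    by (simp add: sum.distrib[symmetric] case_prod_unfold algebra_simps)
  also have "\<dots> = (\<Sum>(x, y)\<in>descents S. mu x y * ((u x - u y) powr (p - 1) * (psi x - psi y)))"
  proof (intro sum.cong refl, clarify)
    fix x y assume "(x, y) \<in> descents S"
    then have "0 < u x - u y" by (simp add: descents_def)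
    moreover have "(u x - u y) powr (p - 1) = (u x - u y) powr (p - 2) * (u x - u y) powr 1"
      by (simp only: powr_add[symmetric]) simp
    ultimately have "Phi p (u x - u y) = (u x - u y) powr (p - 1)"
      by (simp add: Phi_def)
    then show "h x y * (psi x - psi y) = mu x y * ((u x - u y) powr (p - 1) * (psi x - psi y))"
      by (simp add: h_def)
  qed
  finally show ?thesis .
qed

text \<open>The test function is \<open>\<phi>\<^sup>s (1 + M u\<^sup>-\<^sup>a)\<close>: the summand \<open>1\<close> gives the left-hand side, and the
  other one gives the Caccioppoli inequality that absorbs the gradient of \<open>u\<close>. An edge contributes
  a positive term only if \<open>\<phi>\<close> decreases along it together with \<open>u\<close>, so every term is charged to an
  endpoint in the support of \<open>\<phi>\<close>, even when the edge leaves the support.\<close>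

lemma cutoff_estimate:
  assumes S: "finite S" and phi: "\<And>x. 0 \<le> phi x" "\<And>x. phi x \<le> 1" "\<And>x. x \<notin> S \<Longrightarrow> phi x = 0"
    and a: "0 < a" "a \<le> p - 1" "(a + 1) * (p - 1) < q"
    and s: "1 \<le> s" "q * p \<le> s * (q - (a + 1) * (p - 1))"
  defines "C \<equiv> 2 * s / a * (s * (1 + a)) * (2 * (s * (1 + a)) / a) powr (p - 1) + s"
  shows "(\<Sum>x\<in>S. nu x * (u x powr q * phi x powr s))
    \<le> C * (\<Sum>x\<in>S. descent_energy E mu p phi x * (1 + u x powr q * phi x powr s))"
proof -
  define M where "M = 2 * s / a"
  define psi where "psi x = phi x powr s * (1 + M * u x powr (- a))" for x
  define G where "G = {(x, y) \<in> descents S. phi y < phi x}"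
  define R where "R x y = mu x y * ((phi x - phi y) powr p * (1 + u x powr q * phi x powr s))" for x y
  have M: "0 < M" using a s by (simp add: M_def)
  have C: "0 \<le> C" using a s by (auto simp: C_def)
  have R: "0 \<le> R x y" if "{x, y} \<in> E" for x y
    using mu_pos[OF that] by (auto simp: R_def intro!: mult_nonneg_nonneg add_nonneg_nonneg)
  have supp: "x \<in> S" if "phi y < phi x" for x y
    using that phi(1)[of y] phi(3)[of x] by force
  have "(\<Sum>x\<in>S. nu x * (u x powr q * phi x powr s)) \<le> (\<Sum>x\<in>S. nu x * u x powr q * psi x)"
    unfolding psi_def mult.assoc using nu_nonneg M
    by (intro sum_mono mult_left_mono) (auto simp: algebra_simps)
  also have "\<dots> \<le> (\<Sum>(x, y)\<in>descents S. mu x y * ((u x - u y) powr (p - 1) * (psi x - psi y)))"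
    using M phi s by (intro weak_supersolution S) (auto simp: psi_def)
  also have "\<dots> \<le> (\<Sum>(x, y)\<in>descents S. if phi y < phi x then C * R x y else 0)"
  proof (intro sum_mono, clarify)
    fix x y assume "(x, y) \<in> descents S"
    then have xy: "{x, y} \<in> E" "u y < u x" by (auto simp: descents_def)
    show "mu x y * ((u x - u y) powr (p - 1) * (psi x - psi y))
        \<le> (if phi y < phi x then C * R x y else 0)"
    proof (cases "phi y < phi x")
      case True
      have "(u x - u y) powr (p - 1) * (psi x - psi y)
          \<le> C * ((phi x - phi y) powr p * (1 + u x powr q * phi x powr s))"
        unfolding psi_def C_def M_def
        using test_function_pointwise[OF u_pos xy(2) phi(1) True phi(2) p a s] by simp
      then have "mu x y * ((u x - u y) powr (p - 1) * (psi x - psi y))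
          \<le> mu x y * (C * ((phi x - phi y) powr p * (1 + u x powr q * phi x powr s)))"
        using mu_pos[OF xy(1)] by (intro mult_left_mono) auto
      then show ?thesis using True by (simp add: R_def mult_ac)
    next
      case False
      have "u x powr (- a) \<le> u y powr (- a)"
        using u_pos[of y] xy(2) a by (intro powr_mono2') auto
      then have "psi x \<le> psi y"
        unfolding psi_def using False M phi(1) s mult_left_mono[of "u x powr (- a)" "u y powr (- a)" M]
        by (intro mult_mono powr_mono2) auto
      then show ?thesis
        using False mu_pos[OF xy(1)] by (auto intro!: mult_nonneg_nonpos)
    qed
  qed
  also have "\<dots> = C * (\<Sum>(x, y)\<in>G. R x y)"
    unfolding G_def sum_distrib_left using finite_descents[OF S]
    by (intro sum.mono_neutral_cong_right) (auto split: if_splits)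
  also have "(\<Sum>(x, y)\<in>G. R x y) \<le> (\<Sum>(x, y)\<in>Sigma S (\<lambda>x. {y. {x, y} \<in> E \<and> phi y < phi x}). R x y)"
  proof (rule sum_mono2)
    show "finite (Sigma S (\<lambda>x. {y. {x, y} \<in> E \<and> phi y < phi x}))"
      using S finite_nbrs by (auto simp: nbrs_def)
  qed (use supp R in \<open>auto simp: G_def descents_def\<close>)
  also have "\<dots> = (\<Sum>x\<in>S. \<Sum>y | {x, y} \<in> E \<and> phi y < phi x. R x y)"
    using S finite_nbrs by (subst sum.Sigma) (auto simp: nbrs_def)
  also have "\<dots> = (\<Sum>x\<in>S. descent_energy E mu p phi x * (1 + u x powr q * phi x powr s))"
    by (simp add: descent_energy_def R_def sum_distrib_right mult.assoc)
  finally show ?thesis using C by (simp add: mult_left_mono)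
qed

text \<open>The \<open>p\<close>-Laplacian is homogeneous of degree \<open>p - 1\<close>, so scaling \<open>u\<close> only changes \<open>\<nu>\<close> by a factor.\<close>

lemma scaled:
  assumes "0 < T"
  shows "positive_supersolution E mu p q (\<lambda>x. T powr (q - p + 1) * nu x) (\<lambda>x. u x / T)"
proof
  show "locally_finite_graph E" "1 < p" by (fact locally_finite p)+
  show "0 \<le> T powr (q - p + 1) * nu x" "0 < u x / T" for x
    using nu_nonneg u_pos assms by simp_all
  fix x
  have Phi: "Phi p (t / T) = Phi p t / T powr (p - 1)" for t
  proof -
    have "T powr (p - 1) = T powr (p - 2) * T powr 1" by (simp only: powr_add[symmetric]) simp
    then show ?thesis using assms by (simp add: Phi_def powr_divide)
  qed
  have "T powr (q - p + 1) * nu x * (u x / T) powr q = nu x * u x powr q / T powr (p - 1)"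
    using assms u_pos[of x] by (simp add: powr_divide powr_diff powr_add)
  also have "\<dots> \<le> (\<Sum>y\<in>nbrs E x. mu x y * Phi p (u x - u y)) / T powr (p - 1)"
    using supersolution by (intro divide_right_mono) auto
  also have "\<dots> = (\<Sum>y\<in>nbrs E x. mu x y * Phi p (u x / T - u y / T))"
    unfolding diff_divide_distrib[symmetric] Phi by (simp add: sum_divide_distrib)
  finally show "T powr (q - p + 1) * nu x * (u x / T) powr q
      \<le> (\<Sum>y\<in>nbrs E x. mu x y * Phi p (u x / T - u y / T))" .
qed

lemma scaled_cutoff_estimate:
  assumes S: "finite S" and phi: "\<And>x. 0 \<le> phi x" "\<And>x. phi x \<le> 1" "\<And>x. x \<notin> S \<Longrightarrow> phi x = 0"
    and a: "0 < a" "a \<le> p - 1" "(a + 1) * (p - 1) < q"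
    and s: "1 \<le> s" "q * p \<le> s * (q - (a + 1) * (p - 1))"
    and T: "0 < T"
  defines "C \<equiv> 2 * s / a * (s * (1 + a)) * (2 * (s * (1 + a)) / a) powr (p - 1) + s"
  shows "(\<Sum>x\<in>S. nu x * (u x powr q * phi x powr s))
    \<le> C * (T powr (p - 1) * (\<Sum>x\<in>S. descent_energy E mu p phi x)
      + T powr (p - 1 - q) * (\<Sum>x\<in>S. descent_energy E mu p phi x * (u x powr q * phi x powr s)))"
proof -
  interpret v: positive_supersolution E mu p q "\<lambda>x. T powr (q - p + 1) * nu x" "\<lambda>x. u x / T"
    using scaled[OF T] .
  have eq: "T powr (q - p + 1) * nu x * ((u x / T) powr q * phi x powr s)
      = T powr (1 - p) * (nu x * (u x powr q * phi x powr s))" for x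
    using T u_pos[of x] by (simp add: powr_divide powr_diff powr_add)
  have "T powr (1 - p) * (\<Sum>x\<in>S. nu x * (u x powr q * phi x powr s))
      = (\<Sum>x\<in>S. T powr (q - p + 1) * nu x * ((u x / T) powr q * phi x powr s))"
    unfolding sum_distrib_left by (intro sum.cong refl eq[symmetric])
  also have "\<dots> \<le> C * (\<Sum>x\<in>S. descent_energy E mu p phi x * (1 + (u x / T) powr q * phi x powr s))"
    unfolding C_def by (rule v.cutoff_estimate[OF S phi a s])
  also have "(\<Sum>x\<in>S. descent_energy E mu p phi x * (1 + (u x / T) powr q * phi x powr s))
      = (\<Sum>x\<in>S. descent_energy E mu p phi x)
        + (\<Sum>x\<in>S. descent_energy E mu p phi x * (u x powr q * phi x powr s)) / T powr q"
    using T u_pos by (simp add: powr_divide less_imp_le distrib_left sum.distrib sum_divide_distrib)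
  finally have "T powr (p - 1) * (T powr (1 - p) * (\<Sum>x\<in>S. nu x * (u x powr q * phi x powr s)))
      \<le> T powr (p - 1) * (C * ((\<Sum>x\<in>S. descent_energy E mu p phi x)
        + (\<Sum>x\<in>S. descent_energy E mu p phi x * (u x powr q * phi x powr s)) / T powr q))"
    by (rule mult_left_mono) simp
  moreover have "T powr (p - 1) * (T powr (1 - p) * X) = X" for X
    using T by (simp add: mult.assoc[symmetric] powr_add[symmetric])
  moreover have "T powr (p - 1) * (C * (X + Y / T powr q))
      = C * (T powr (p - 1) * X + T powr (p - 1 - q) * Y)" for X Y
    by (simp add: powr_diff[of T "p - 1" q] distrib_left)
  ultimately show ?thesis by (simp only:)
qed

text \<open>A lower bound for the mass of \<open>u\<^sup>q\<close> in the region where the cutoff varies, superlinear in \<open>F\<close>. The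
  choice of \<open>T\<close> makes the first term of the scaled estimate at most half of its left-hand side.\<close>

lemma cutoff_growth:
  assumes S: "finite S" and phi: "\<And>x. 0 \<le> phi x" "\<And>x. phi x \<le> 1" "\<And>x. x \<notin> S \<Longrightarrow> phi x = 0"
    and a: "0 < a" "a \<le> p - 1" "(a + 1) * (p - 1) < q"
    and s: "1 \<le> s" "q * p \<le> s * (q - (a + 1) * (p - 1))"
    and W: "(\<Sum>x\<in>S. descent_energy E mu p phi x) \<le> W" "0 < W"
  defines "C \<equiv> 2 * s / a * (s * (1 + a)) * (2 * (s * (1 + a)) / a) powr (p - 1) + s"
    and "F \<equiv> \<Sum>x\<in>S. nu x * (u x powr q * phi x powr s)"
  assumes F: "0 < F"
  shows "F / (2 * C) * (F / (2 * C * W)) powr ((q - p + 1) / (p - 1))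
    \<le> (\<Sum>x\<in>S. descent_energy E mu p phi x * (u x powr q * phi x powr s))"
proof -
  define A where "A = (\<Sum>x\<in>S. descent_energy E mu p phi x * (u x powr q * phi x powr s))"
  define B where "B = F / (2 * C * W)"
  define T where "T = B powr (1 / (p - 1))"
  have "0 \<le> 2 * s / a * (s * (1 + a)) * (2 * (s * (1 + a)) / a) powr (p - 1)"
    using s a by auto
  then have C: "0 < C" using s unfolding C_def by linarith
  have B: "0 < B" using F C W by (simp add: B_def)
  then have T: "0 < T" by (simp add: T_def)
  have T1: "T powr (p - 1) = B" using B p by (simp add: T_def powr_powr)
  have T2: "T powr (q - p + 1) = B powr ((q - p + 1) / (p - 1))"
    by (simp add: T_def powr_powr)
  have "T powr (p - 1 - q) * T powr (q - p + 1) = 1"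
    using T by (simp add: powr_add[symmetric])
  have "F \<le> C * (T powr (p - 1) * (\<Sum>x\<in>S. descent_energy E mu p phi x) + T powr (p - 1 - q) * A)"
    unfolding F_def A_def C_def by (rule scaled_cutoff_estimate[OF S phi a s T])
  also have "\<dots> \<le> C * (B * W + T powr (p - 1 - q) * A)"
    using W B C unfolding T1 by (intro mult_left_mono add_right_mono) auto
  also have "\<dots> = F / 2 + C * (T powr (p - 1 - q) * A)"
    using C W by (simp add: B_def field_simps)
  finally have "F / (2 * C) \<le> T powr (p - 1 - q) * A"
    using C by (simp add: field_simps)
  then have "F / (2 * C) * T powr (q - p + 1) \<le> T powr (p - 1 - q) * A * T powr (q - p + 1)"
    by (rule mult_right_mono) simp
  also have "\<dots> = A" using \<open>T powr (p - 1 - q) * T powr (q - p + 1) = 1\<close> by (simp add: mult_ac)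
  finally show ?thesis unfolding T2 B_def A_def .
qed

end

section \<open>Finiteness of balls\<close>

lemma path_lengths_first_edge:
  assumes "s \<in> path_lengths E rho x z"
  shows "x = z \<or> (\<exists>y s'. {x, y} \<in> E \<and> s' \<in> path_lengths E rho y z \<and> s = rho x y + s')"
proof -
  obtain m :: nat and f where f: "s = (\<Sum>i=1..m. rho (f (i - 1)) (f i))" "f 0 = x" "f m = z"
      "\<forall>i\<in>{1..m}. {f (i - 1), f i} \<in> E"
    using assms unfolding path_lengths_def by blast
  show ?thesis
  proof (cases m)
    case (Suc n)
    define g where "g i = f (Suc i)" for i
    have "(\<Sum>i=1..m. rho (f (i - 1)) (f i)) = (\<Sum>i<m. rho (f i) (f (Suc i)))"
      by (rule sum.reindex_bij_witness[where i = Suc and j = "\<lambda>i. i - 1"]) auto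
    also have "\<dots> = rho (f 0) (f 1) + (\<Sum>i<n. rho (g i) (g (Suc i)))"
      unfolding Suc g_def by (subst sum.lessThan_Suc_shift) simp
    also have "(\<Sum>i<n. rho (g i) (g (Suc i))) = (\<Sum>i=1..n. rho (g (i - 1)) (g i))"
      by (rule sum.reindex_bij_witness[where i = "\<lambda>i. i - 1" and j = Suc]) auto
    finally have s: "s = rho x (g 0) + (\<Sum>i=1..n. rho (g (i - 1)) (g i))"
      using f by (simp add: g_def)
    have "{g (i - 1), g i} \<in> E" if "i \<in> {1..n}" for i
      using f(4)[rule_format, of "Suc i"] that Suc by (auto simp: g_def)
    then have "(\<Sum>i=1..n. rho (g (i - 1)) (g i)) \<in> path_lengths E rho (g 0) z"
      unfolding path_lengths_def mem_Collect_eq using f(3) Suc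
      by (intro exI[of _ n] exI[of _ g] conjI ballI) (simp_all add: g_def)
    moreover have "{x, g 0} \<in> E"
      using f(4)[rule_format, of 1] f(2) Suc by (simp add: g_def)
    ultimately show ?thesis using s by blast
  qed (use f in simp)
qed

lemma path_dist_edge_le:
  assumes "edge_length E rho" "{x, y} \<in> E"
  shows "path_dist E rho x y \<le> rho x y"
proof (cases "x = y")
  case True
  then show ?thesis using assms by (auto simp: path_dist_def edge_length_def intro: less_imp_le)
next
  case False
  have "rho x y \<in> path_lengths E rho x y"
    unfolding path_lengths_def mem_Collect_eq using assms(2)
    by (intro exI[of _ 1] exI[of _ "\<lambda>i. if i = 0 then x else y"]) auto
  then show ?thesis
    using False path_lengths_bdd_below[OF assms(1)] by (simp add: path_dist_def cInf_lower)
qed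

text \<open>Every vertex is isolated in the path metric, with the shortest adjacent edge as a bound.\<close>

lemma path_dist_isolated:
  assumes "locally_finite_graph E" "connected_graph E" "edge_length E rho"
  obtains e where "0 < e" "\<And>y. path_dist E rho z y < e \<Longrightarrow> y = z"
proof -
  define e where "e = Min (insert 1 (rho z ` nbrs E z))"
  have fin: "finite (nbrs E z)" using assms(1) by (simp add: locally_finite_graph_def)
  have "0 < rho z w" if "w \<in> nbrs E z" for w
    using that assms(3) unfolding nbrs_def edge_length_def by blast
  then have "0 < e" using fin by (auto simp: e_def)
  moreover have "y = z" if "path_dist E rho z y < e" for y
  proof (rule ccontr)
    assume "y \<noteq> z"
    have "e \<le> Inf (path_lengths E rho z y)"
    proof (rule cInf_greatest)
      show "path_lengths E rho z y \<noteq> {}" by (rule path_lengths_nonempty[OF assms(2)])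
      fix s assume "s \<in> path_lengths E rho z y"
      then obtain w s' where w: "{z, w} \<in> E" "s' \<in> path_lengths E rho w y" "s = rho z w + s'"
        using path_lengths_first_edge[of s E rho z y] \<open>y \<noteq> z\<close> by blast
      have "e \<le> rho z w" using fin w(1) by (auto simp: e_def nbrs_def intro!: Min_le)
      then show "e \<le> s" using path_lengths_nonneg[OF assms(3) w(2)] w(3) by linarith
    qed
    then show False using that \<open>y \<noteq> z\<close> by (simp add: path_dist_def)
  qed
  ultimately show ?thesis using that by blast
qed

text \<open>The discrete Hopf--Rinow theorem. An infinite ball contains, by Koenig's lemma, an infinite
  path of finite length. Its vertices form a Cauchy sequence, which has no limit because every
  vertex is isolated and every edge has positive length.\<close>

lemma finite_path_ball:
  assumes lf: "locally_finite_graph E" and conn: "connected_graph E" and el: "edge_length E rho"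
    and complete: "Metric_space.mcomplete UNIV (path_dist E rho)"
  shows "finite (path_ball E rho x0 r)"
proof (rule ccontr)
  interpret Metric_space UNIV "path_dist E rho"
    by (rule Metric_space_path_dist[OF lf conn el])
  define reach where "reach x t = {z. \<exists>s\<in>path_lengths E rho x z. s < t}" for x and t :: real
  assume inf: "infinite (path_ball E rho x0 r)"
  have "path_ball E rho x0 r \<subseteq> insert x0 (reach x0 (r + 1))"
  proof
    fix z assume z: "z \<in> path_ball E rho x0 r"
    show "z \<in> insert x0 (reach x0 (r + 1))"
    proof (cases "z = x0")
      case False
      then have "Inf (path_lengths E rho x0 z) < r + 1"
        using z by (auto simp: path_ball_def path_dist_def split: if_splits)
      then show ?thesis
        using cInf_lessD[OF path_lengths_nonempty[OF conn]] by (auto simp: reach_def)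
    qed simp
  qed
  with inf have start: "infinite (reach x0 (r + 1))"
    using finite_subset by fastforce
  have step: "\<exists>y. {x, y} \<in> E \<and> infinite (reach y (t - rho x y))" if "infinite (reach x t)" for x t
  proof (rule ccontr)
    assume "\<not> ?thesis"
    then have "finite (insert x (\<Union>y\<in>nbrs E x. reach y (t - rho x y)))"
      using lf by (auto simp: nbrs_def locally_finite_graph_def)
    moreover have "reach x t \<subseteq> insert x (\<Union>y\<in>nbrs E x. reach y (t - rho x y))"
    proof
      fix z assume "z \<in> reach x t"
      then obtain s where "s \<in> path_lengths E rho x z" "s < t" by (auto simp: reach_def)
      then show "z \<in> insert x (\<Union>y\<in>nbrs E x. reach y (t - rho x y))"
        using path_lengths_first_edge[of s E rho x z] by (force simp: reach_def nbrs_def)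
    qed
    ultimately show False using that finite_subset by blast
  qed
  have "\<exists>f. \<forall>n. infinite (reach (fst (f n)) (snd (f n))) \<and>
      ({fst (f n), fst (f (Suc n))} \<in> E \<and>
       snd (f (Suc n)) = snd (f n) - rho (fst (f n)) (fst (f (Suc n))))"
  proof (rule dependent_nat_choice)
    show "\<exists>e. infinite (reach (fst e) (snd e))" using start by auto
    show "\<exists>e'. infinite (reach (fst e') (snd e')) \<and>
        ({fst e, fst e'} \<in> E \<and> snd e' = snd e - rho (fst e) (fst e'))"
      if "infinite (reach (fst e) (snd e))" for e and n :: nat
      using step[OF that] by auto
  qed
  then obtain f where f: "\<And>n. infinite (reach (fst (f n)) (snd (f n)))"
      "\<And>n. {fst (f n), fst (f (Suc n))} \<in> E"
      "\<And>n. snd (f (Suc n)) = snd (f n) - rho (fst (f n)) (fst (f (Suc n)))"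
    by blast
  define x t where "x n = fst (f n)" and "t n = snd (f n)" for n
  have edge: "{x n, x (Suc n)} \<in> E" and t_Suc: "t (Suc n) = t n - rho (x n) (x (Suc n))" for n
    using f by (simp_all add: x_def t_def)
  have rho_pos: "0 < rho (x n) (x (Suc n))" for n
    using el edge by (simp add: edge_length_def)
  have "0 \<le> t n" for n
  proof -
    have "reach (x n) (t n) \<noteq> {}" using f(1)[of n] by (auto simp: x_def t_def)
    then show ?thesis using path_lengths_nonneg[OF el] by (force simp: reach_def)
  qed
  moreover have "decseq t"
    unfolding decseq_Suc_iff using rho_pos by (simp add: t_Suc less_imp_le)
  ultimately have "Cauchy t"
    using decseq_convergent[of t 0] LIMSEQ_imp_Cauchy by blast
  have dist: "path_dist E rho (x n) (x (n + k)) \<le> t n - t (n + k)" for n k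
  proof (induction k)
    case (Suc k)
    have "path_dist E rho (x n) (x (n + Suc k))
        \<le> path_dist E rho (x n) (x (n + k)) + path_dist E rho (x (n + k)) (x (Suc (n + k)))"
      using triangle[of "x n" "x (n + k)" "x (n + Suc k)"] by simp
    then show ?case
      using Suc path_dist_edge_le[OF el edge[of "n + k"]] t_Suc[of "n + k"] by simp
  qed simp
  have dist': "path_dist E rho (x n) (x n') \<le> \<bar>t n - t n'\<bar>" for n n'
  proof (cases "n \<le> n'")
    case True
    then show ?thesis using dist[of n "n' - n"] by simp
  next
    case False
    then show ?thesis using dist[of n' "n - n'"] commute[of "x n" "x n'"] by simp
  qed
  have "MCauchy x"
    unfolding MCauchy_def
  proof (intro conjI allI impI)
    fix e :: real assume "0 < e"
    then obtain N where "\<And>n n'. N \<le> n \<Longrightarrow> N \<le> n' \<Longrightarrow> \<bar>t n - t n'\<bar> < e"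
      using \<open>Cauchy t\<close> unfolding Cauchy_def dist_real_def by blast
    then show "\<exists>N. \<forall>n n'. N \<le> n \<longrightarrow> N \<le> n' \<longrightarrow> path_dist E rho (x n) (x n') < e"
      using dist' le_less_trans by blast
  qed simp
  then obtain z where z: "limitin mtopology x z sequentially"
    using complete by (auto simp: mcomplete_def)
  obtain e where e: "0 < e" "\<And>y. path_dist E rho z y < e \<Longrightarrow> y = z"
    using path_dist_isolated[OF lf conn el] by blast
  have "\<forall>\<^sub>F n in sequentially. path_dist E rho (x n) z < e"
    using z e(1) by (auto simp: limitin_metric elim: eventually_mono)
  then obtain N where N: "\<And>n. N \<le> n \<Longrightarrow> x n = z"
    unfolding eventually_sequentially using e(2) commute[of z] by metis
  have "0 < rho z z" using rho_pos[of N] N[of N] N[of "Suc N"] by simp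
  then obtain N' where "\<And>n n'. N' \<le> n \<Longrightarrow> N' \<le> n' \<Longrightarrow> \<bar>t n - t n'\<bar> < rho z z"
    using \<open>Cauchy t\<close> unfolding Cauchy_def dist_real_def by blast
  then have "\<bar>t (N + N') - t (Suc (N + N'))\<bar> < rho z z" by simp
  then show False using N[of "N + N'"] N[of "Suc (N + N')"] by (simp add: t_Suc)
qed

lemma path_dist_edge_lipschitz:
  assumes "locally_finite_graph E" "connected_graph E" "edge_length E rho" "{x, y} \<in> E"
  shows "path_dist E rho x0 y - path_dist E rho x0 x \<le> rho x y"
proof -
  interpret Metric_space UNIV "path_dist E rho"
    by (rule Metric_space_path_dist[OF assms(1-3)])
  show ?thesis
    using triangle[of x0 x y] path_dist_edge_le[OF assms(3,4)] by simp
qed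

section \<open>Dyadic cutoff functions\<close>

text \<open>The cutoff as a function of the distance \<open>t\<close> to the centre: \<open>1\<close> up to \<open>R\<close>, \<open>0\<close> from \<open>2 R\<close> on, and affine
  in between.\<close>

definition cutoff :: "real \<Rightarrow> real \<Rightarrow> real" where
  "cutoff R t = max 0 (min 1 (2 - t / R))"

lemma cutoff_bounds: "0 \<le> cutoff R t" "cutoff R t \<le> 1"
  by (auto simp: cutoff_def)

lemma cutoff_eq_0: "0 < R \<Longrightarrow> 2 * R \<le> t \<Longrightarrow> cutoff R t = 0"
  using pos_le_divide_eq[of R 2 t] by (simp add: cutoff_def)

lemma cutoff_antimono: "0 < R \<Longrightarrow> t \<le> t' \<Longrightarrow> cutoff R t' \<le> cutoff R t"
  using divide_right_mono[of t t' R] by (auto simp: cutoff_def)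

lemma cutoff_mono_radius: "0 < R \<Longrightarrow> R \<le> R' \<Longrightarrow> 0 \<le> t \<Longrightarrow> cutoff R t \<le> cutoff R' t"
  using divide_left_mono[of R R' t] by (auto simp: cutoff_def)

lemma cutoff_telescope:
  assumes "0 < R"
  shows "R * cutoff R t = max 0 (2 * R - t) - max 0 (R - t)"
  using assms by (auto simp: cutoff_def max_def min_def field_simps)

text \<open>The \<open>k\<close>-th summand is the length of the part of the interval from \<open>t\<close> to \<open>t'\<close> that lies between
  \<open>2\<^sup>k / 2\<close> and \<open>2\<^sup>k\<close>.\<close>

lemma sum_cutoff_differences_le:
  fixes t t' :: real
  assumes "t \<le> t'"
  shows "(\<Sum>k<n. (2 ^ k / 2) * (cutoff (2 ^ k / 2) t - cutoff (2 ^ k / 2) t')) \<le> t' - t"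
proof -
  define g where "g k = max 0 (2 ^ k / 2 - t) - max 0 (2 ^ k / 2 - t')" for k :: nat
  have "(2 ^ k / 2) * (cutoff (2 ^ k / 2) t - cutoff (2 ^ k / 2) t') = g (Suc k) - g k" for k
    unfolding right_diff_distrib by (subst (1 2) cutoff_telescope) (simp_all add: g_def)
  then have "(\<Sum>k<n. (2 ^ k / 2) * (cutoff (2 ^ k / 2) t - cutoff (2 ^ k / 2) t')) = g n - g 0"
    by (simp only: sum_lessThan_telescope)
  also have "\<dots> \<le> t' - t" using assms by (auto simp: g_def max_def)
  finally show ?thesis .
qed

lemma sum_powr_le_powr_sum:
  fixes f :: "'b \<Rightarrow> real"
  assumes "\<And>i. i \<in> I \<Longrightarrow> 0 \<le> f i" "1 \<le> p"
  shows "(\<Sum>i\<in>I. f i powr p) \<le> (\<Sum>i\<in>I. f i) powr p"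
proof (cases "finite I")
  case True
  define X where "X = (\<Sum>i\<in>I. f i)"
  have X: "0 \<le> X" using assms by (simp add: X_def sum_nonneg)
  have mult: "y powr p = y * y powr (p - 1)" if "0 \<le> y" for y :: real
    using that powr_mult_base[of y "p - 1"] by simp
  have "f i powr p \<le> f i * X powr (p - 1)" if "i \<in> I" for i
  proof -
    have "f i \<le> X" unfolding X_def using that assms True by (intro member_le_sum) auto
    then show ?thesis
      using that assms by (simp add: mult) (intro mult_left_mono powr_mono2, auto)
  qed
  then have "(\<Sum>i\<in>I. f i powr p) \<le> (\<Sum>i\<in>I. f i * X powr (p - 1))" by (rule sum_mono)
  also have "\<dots> = X powr p" using X by (simp add: mult X_def sum_distrib_right)
  finally show ?thesis by (simp add: X_def)
qed simp

text \<open>An edge may cross many dyadic annuli. The weighted energies of the dyadic cutoffs still sum up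
  to at most \<open>\<nu>\<close>: along an edge, the differences of the rescaled cutoffs add up to at most its
  length.\<close>

lemma sum_descent_energy_cutoff_le:
  assumes graph: "weighted_graph E mu" "locally_finite_graph E" "connected_graph E"
    and adapted: "p_adapted E mu p nu rho" and p: "1 \<le> p"
  shows "(\<Sum>k<n. (2 ^ k / 2) powr p *
      descent_energy E mu p (\<lambda>x. cutoff (2 ^ k / 2) (path_dist E rho x0 x)) x) \<le> nu x"
proof -
  define d where "d = path_dist E rho x0"
  define D where "D k y = (2 ^ k / 2) * max 0 (cutoff (2 ^ k / 2) (d x) - cutoff (2 ^ k / 2) (d y))"
    for k :: nat and y
  have el: "edge_length E rho" using adapted by (simp add: p_adapted_def)
  have fin: "finite (nbrs E x)" using graph by (simp add: locally_finite_graph_def)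
  have energy: "(2 ^ k / 2) powr p * descent_energy E mu p (\<lambda>x. cutoff (2 ^ k / 2) (d x)) x
      = (\<Sum>y\<in>nbrs E x. mu x y * D k y powr p)" for k
  proof -
    have "descent_energy E mu p (\<lambda>x. cutoff (2 ^ k / 2) (d x)) x
      = (\<Sum>y\<in>nbrs E x. mu x y * max 0 (cutoff (2 ^ k / 2) (d x) - cutoff (2 ^ k / 2) (d y)) powr p)"
      unfolding descent_energy_def using fin
      by (intro sum.mono_neutral_cong_left) (auto simp: nbrs_def max_def)
    then show ?thesis
      unfolding D_def powr_mult by (simp add: sum_distrib_left mult_ac)
  qed
  have D_sum: "(\<Sum>k<n. D k y) \<le> rho x y" if y: "y \<in> nbrs E x" for y
  proof (cases "d x \<le> d y")
    case True
    have "D k y = (2 ^ k / 2) * (cutoff (2 ^ k / 2) (d x) - cutoff (2 ^ k / 2) (d y))" for k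
      using cutoff_antimono[of "2 ^ k / 2" "d x" "d y"] True by (simp add: D_def)
    then have "(\<Sum>k<n. D k y) \<le> d y - d x"
      using sum_cutoff_differences_le[OF True] by (simp only:)
    also have "\<dots> \<le> rho x y"
      unfolding d_def using y by (intro path_dist_edge_lipschitz graph el) (simp add: nbrs_def)
    finally show ?thesis .
  next
    case False
    then have "D k y = 0" for k
      using cutoff_antimono[of "2 ^ k / 2" "d y" "d x"] by (simp add: D_def)
    then show ?thesis using el y by (simp add: edge_length_def nbrs_def less_imp_le)
  qed
  have D_nonneg: "0 \<le> D k y" for k y by (simp add: D_def)
  have "(\<Sum>k<n. \<Sum>y\<in>nbrs E x. mu x y * D k y powr p) = (\<Sum>y\<in>nbrs E x. mu x y * (\<Sum>k<n. D k y powr p))"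
    by (subst sum.swap) (simp add: sum_distrib_left)
  also have "\<dots> \<le> (\<Sum>y\<in>nbrs E x. mu x y * rho x y powr p)"
  proof (intro sum_mono mult_left_mono)
    fix y assume y: "y \<in> nbrs E x"
    have "(\<Sum>k<n. D k y powr p) \<le> (\<Sum>k<n. D k y) powr p"
      using D_nonneg p by (intro sum_powr_le_powr_sum)
    also have "\<dots> \<le> rho x y powr p"
      using D_sum[OF y] D_nonneg p by (intro powr_mono2 sum_nonneg) auto
    finally show "(\<Sum>k<n. D k y powr p) \<le> rho x y powr p" .
    show "0 \<le> mu x y" using weighted_graph.mu_pos[OF graph(1)] y by (simp add: nbrs_def less_imp_le)
  qed
  also have "\<dots> \<le> nu x" using adapted by (simp add: p_adapted_def)
  finally show ?thesis unfolding energy[symmetric] unfolding d_def .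
qed

section \<open>Discrete blow-up\<close>

text \<open>A discrete form of the fact that \<open>F' \<ge> c F\<^sup>1\<^sup>+\<^sup>b\<close> has a positive solution on a half-line only if
  \<open>c\<close> is integrable. The partial sums \<open>H\<close> of \<open>A\<close> play the role of \<open>F\<close>, and \<open>H\<^sup>-\<^sup>b\<close> decreases by at least
  a multiple of \<open>c\<close>. The bound \<open>A k \<le> F k\<close> excludes solutions that jump, such as
  \<open>F (k + 1) = F k\<^sup>1\<^sup>+\<^sup>b\<close> for constant \<open>c\<close>.\<close>

lemma summable_of_superlinear_growth:
  fixes A F c :: "nat \<Rightarrow> real"
  assumes b: "0 < b" and \<kappa>: "0 < \<kappa>" and F: "\<And>k. 0 < F k" and c: "\<And>k. 0 < c k"
    and growth: "\<And>k. \<kappa> * c k * F k powr (1 + b) \<le> A k"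
    and AF: "\<And>k. A k \<le> F k" and sum_AF: "\<And>k. (\<Sum>j<k. A j) \<le> F k"
  shows "summable c"
proof -
  define H where "H k = (\<Sum>j<k. A j)" for k
  define G where "G k = H k powr (- b)" for k
  define \<delta> where "\<delta> = \<kappa> * (b / 2) / (1 + b / 2)"
  have \<delta>: "0 < \<delta>" using b \<kappa> by (simp add: \<delta>_def)
  have A: "0 < A k" for k
  proof -
    have "0 < \<kappa> * c k * F k powr (1 + b)" using \<kappa> c[of k] F[of k] by simp
    then show ?thesis using growth[of k] by linarith
  qed
  have H: "0 < H (Suc k)" for k
    unfolding H_def using A by (intro sum_pos) auto
  have step: "\<delta> * c (Suc k) \<le> G (Suc k) - G (Suc (Suc k))" for k
  proof -
    \<comment> \<open>The relative increment of \<open>H\<close> is at least \<open>t\<close>, and \<open>t \<le> 1\<close>.\<close>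
    define h f t where "h = H (Suc k)" and "f = F (Suc k)" and "t = \<kappa> * c (Suc k) * h powr b"
    have h: "0 < h" "h \<le> f" using H sum_AF[of "Suc k"] by (simp_all add: h_def f_def H_def)
    have t0: "0 \<le> t" using \<kappa> c[of "Suc k"] by (simp add: t_def)
    have "f * (\<kappa> * c (Suc k) * f powr b) = \<kappa> * c (Suc k) * f powr (1 + b)"
      using h by (simp add: powr_add)
    also have "\<dots> \<le> f * 1"
      using order.trans[OF growth AF] by (simp only: f_def mult_1_right)
    finally have "\<kappa> * c (Suc k) * f powr b \<le> 1"
      using F[of "Suc k"] unfolding f_def by (rule mult_left_le_imp_le)
    moreover have "t \<le> \<kappa> * c (Suc k) * f powr b"
      unfolding t_def using \<kappa> c[of "Suc k"] h b by (intro mult_left_mono powr_mono2) auto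
    ultimately have t1: "t \<le> 1" by linarith
    have "h * (1 + t) = h + \<kappa> * c (Suc k) * h powr (1 + b)"
      using h by (simp add: t_def powr_add algebra_simps)
    also have "\<dots> \<le> h + \<kappa> * c (Suc k) * f powr (1 + b)"
      using \<kappa> c[of "Suc k"] h b by (intro add_left_mono mult_left_mono powr_mono2) auto
    also have "\<dots> \<le> h + A (Suc k)" using growth[of "Suc k"] by (simp add: f_def)
    also have "\<dots> = H (Suc (Suc k))" by (simp add: h_def H_def)
    finally have "G (Suc (Suc k)) \<le> (h * (1 + t)) powr (- b)"
      unfolding G_def using h t0 b by (intro powr_mono2') auto
    also have "\<dots> = h powr (- b) * (1 + t) powr (- b)" using h t0 by (simp add: powr_mult)
    also have "(1 + t) powr (- b) \<le> 1 / (1 + b * t / 2)"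
    proof -
      have "- ln (1 + t) = ln (1 / (1 + t))" using t0 by (simp add: ln_div)
      also have "\<dots> \<le> 1 / (1 + t) - 1" using t0 by (intro ln_le_minus_one) simp
      also have "\<dots> = - (t / (1 + t))" using t0 by (simp add: field_simps)
      also have "\<dots> \<le> - (t / 2)" using t0 t1 divide_left_mono[of "1 + t" 2 t] by simp
      finally have "b * (t / 2) \<le> b * ln (1 + t)" using b by (intro mult_left_mono) auto
      then have "1 + b * t / 2 \<le> exp (b * ln (1 + t))"
        using exp_ge_add_one_self[of "b * ln (1 + t)"] unfolding times_divide_eq_right by linarith
      then have "1 + b * t / 2 \<le> (1 + t) powr b" using t0 by (simp add: powr_def)
      moreover have "0 < 1 + b * t / 2" using t0 b by (simp add: add_pos_nonneg)
      ultimately show ?thesis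
        unfolding powr_minus_divide by (intro divide_left_mono mult_pos_pos) auto
    qed
    finally have "G (Suc (Suc k)) \<le> h powr (- b) * (1 / (1 + b * t / 2))"
      by (simp add: mult_left_mono)
    moreover have "y - y * (1 / (1 + z)) = y * z / (1 + z)" if "0 \<le> z" for y z :: real
    proof -
      have "1 + z \<noteq> 0" using that by linarith
      then show ?thesis by (simp add: field_simps)
    qed
    from this[of "b * t / 2" "h powr (- b)"]
    have "h powr (- b) - h powr (- b) * (1 / (1 + b * t / 2))
        = h powr (- b) * (b * t / 2) / (1 + b * t / 2)"
      using t0 b by simp
    moreover have "h powr (- b) * (b * t / 2) = \<kappa> * (b / 2) * c (Suc k)"
    proof -
      have "h powr (- b) * h powr b = 1" using h by (simp add: powr_add[symmetric])
      moreover have "h powr (- b) * (b * t / 2) = h powr (- b) * h powr b * (\<kappa> * (b / 2) * c (Suc k))"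
        by (simp add: t_def mult_ac)
      ultimately show ?thesis by simp
    qed
    moreover have "\<kappa> * (b / 2) * c (Suc k) / (1 + b / 2) \<le> \<kappa> * (b / 2) * c (Suc k) / (1 + b * t / 2)"
    proof (rule divide_left_mono)
      have "b * t \<le> b" using b t1 by (simp add: mult_left_le)
      then show "1 + b * t / 2 \<le> 1 + b / 2" by simp
      have "0 \<le> b * t / 2" using b t0 by simp
      then show "0 < (1 + b / 2) * (1 + b * t / 2)" using b by (intro mult_pos_pos) linarith+
      show "0 \<le> \<kappa> * (b / 2) * c (Suc k)" using \<kappa> b c[of "Suc k"] by simp
    qed
    moreover have "\<delta> * c (Suc k) = \<kappa> * (b / 2) * c (Suc k) / (1 + b / 2)"
      by (simp add: \<delta>_def)
    moreover have "h powr (- b) = G (Suc k)" by (simp add: G_def h_def)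
    ultimately show ?thesis by (simp only:)
  qed
  have "(\<Sum>k<n. c (Suc k)) \<le> G 1 / \<delta>" for n
  proof -
    have "\<delta> * (\<Sum>k<n. c (Suc k)) \<le> (\<Sum>k<n. G (Suc k) - G (Suc (Suc k)))"
      unfolding sum_distrib_left using step by (intro sum_mono)
    also have "\<dots> = G 1 - G (Suc n)"
      using sum_lessThan_telescope'[of "\<lambda>k. G (Suc k)" n] by simp
    also have "\<dots> \<le> G 1" by (simp add: G_def)
    finally show ?thesis using \<delta> by (simp add: field_simps)
  qed
  then have "(\<Sum>k\<le>n. c (Suc k)) \<le> G 1 / \<delta>" for n
    by (simp only: lessThan_Suc_atMost[symmetric])
  then have "summable (\<lambda>k. c (Suc k))"
    by (rule bounded_imp_summable[rotated]) (use c in \<open>auto intro: less_imp_le\<close>)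
  then show ?thesis by (simp add: summable_Suc_iff)
qed

section \<open>The volume condition in dyadic form\<close>

text \<open>The integral needs no measurability of \<open>V\<close>, since the integrand is bounded by a step function.\<close>

lemma dyadic_integral_finite:
  fixes V :: "real \<Rightarrow> real"
  assumes \<alpha>: "0 \<le> \<alpha>" and b: "0 \<le> b"
    and V: "\<And>r. 1 \<le> r \<Longrightarrow> 0 < V r" "\<And>r r'. 1 \<le> r \<Longrightarrow> r \<le> r' \<Longrightarrow> V r \<le> V r'"
    and sum: "summable (\<lambda>k. (2 ^ k) powr (\<alpha> + 1) / V (2 ^ k) powr b)"
  shows "(\<integral>\<^sup>+ r\<in>{1..}. ennreal (r powr \<alpha> / V r powr b) \<partial>lborel) < \<infinity>"
proof -
  define I where "I k = {2 ^ k..<2 ^ Suc k :: real}" for k :: nat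
  define g where "g k = (2 ^ Suc k) powr \<alpha> / V (2 ^ k) powr b" for k :: nat
  have bound: "ennreal (r powr \<alpha> / V r powr b) * indicator {1..} r
      \<le> (\<Sum>k. ennreal (g k) * indicator (I k) r)" for r
  proof (cases "1 \<le> r")
    case True
    obtain n where "r < 2 ^ n" using real_arch_pow[of 2 r] by auto
    define m where "m = (LEAST n. r < 2 ^ n)"
    have m: "r < 2 ^ m" unfolding m_def by (rule LeastI) (fact \<open>r < 2 ^ n\<close>)
    then obtain k where k: "m = Suc k" using True by (cases m) auto
    have "2 ^ k \<le> r" using not_less_Least[of k "\<lambda>n. r < 2 ^ n"] k unfolding m_def by force
    then have rI: "r \<in> I k" using m k by (simp add: I_def)
    have "r powr \<alpha> / V r powr b \<le> g k"
      unfolding g_def using \<alpha> b True \<open>2 ^ k \<le> r\<close> m k V(1)[of "2 ^ k"]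
      by (intro frac_le powr_mono2 V) auto
    define h where "h k = ennreal (g k) * indicator (I k) r" for k
    have "ennreal (r powr \<alpha> / V r powr b) * indicator {1..} r \<le> h k"
      using \<open>r powr \<alpha> / V r powr b \<le> g k\<close> True rI by (simp add: h_def ennreal_leI)
    also have "\<dots> \<le> suminf h" using sum_le_suminf[of h "{k}"] by simp
    finally show ?thesis by (simp add: h_def[abs_def])
  qed simp
  have "(\<integral>\<^sup>+ r\<in>{1..}. ennreal (r powr \<alpha> / V r powr b) \<partial>lborel)
      \<le> (\<integral>\<^sup>+ r. (\<Sum>k. ennreal (g k) * indicator (I k) r) \<partial>lborel)"
    using bound by (intro nn_integral_mono) auto
  also have "\<dots> = (\<Sum>k. \<integral>\<^sup>+ r. ennreal (g k) * indicator (I k) r \<partial>lborel)"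
    by (intro nn_integral_suminf) (auto simp: I_def)
  also have "\<dots> = (\<Sum>k. ennreal (2 powr \<alpha> * ((2 ^ k) powr (\<alpha> + 1) / V (2 ^ k) powr b)))"
  proof (intro suminf_cong)
    fix k
    have "(\<integral>\<^sup>+ r. ennreal (g k) * indicator (I k) r \<partial>lborel) = ennreal (g k) * ennreal (2 ^ k)"
      by (subst nn_integral_cmult_indicator) (simp_all add: I_def)
    also have "\<dots> = ennreal (g k * 2 ^ k)"
      by (rule ennreal_mult[symmetric]) (simp_all add: g_def)
    also have "g k * 2 ^ k = 2 powr \<alpha> * ((2 ^ k) powr (\<alpha> + 1) / V (2 ^ k) powr b)"
      by (simp add: g_def powr_add powr_mult)
    finally show "(\<integral>\<^sup>+ r. ennreal (g k) * indicator (I k) r \<partial>lborel)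
        = ennreal (2 powr \<alpha> * ((2 ^ k) powr (\<alpha> + 1) / V (2 ^ k) powr b))" .
  qed
  also have "\<dots> < \<infinity>"
    using ennreal_suminf_neq_top[OF summable_mult[OF sum]] by (simp add: top.not_eq_extremum)
  finally show ?thesis .
qed

section \<open>The Liouville theorem\<close>

lemma vertex_measure_pos:
  assumes "infinite (UNIV :: 'v set)" "weighted_graph E mu" "connected_graph E"
    "locally_finite_graph (E :: 'v set set)"
  shows "0 < vertex_measure E mu x"
proof -
  obtain y where "y \<noteq> x" using ex_new_if_finite[OF assms(1), of "{x}"] by auto
  moreover have "(x, y) \<in> {(a, b). {a, b} \<in> E}\<^sup>*"
    using assms(3) unfolding connected_graph_def by blast
  ultimately obtain z where "(x, z) \<in> {(a, b). {a, b} \<in> E}" by (metis converse_rtranclE)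
  then have "{x, z} \<in> E" by simp
  then show ?thesis
    unfolding vertex_measure_def using assms weighted_graph.mu_pos[OF assms(2)]
    by (intro sum_pos) (auto simp: nbrs_def locally_finite_graph_def)
qed

text \<open>The strong minimum principle: the zero set of a nonnegative supersolution is closed under
  passing to neighbours.\<close>

lemma supersolution_pos_or_zero:
  fixes u :: "'v \<Rightarrow> real"
  assumes graph: "weighted_graph E mu" "connected_graph E" "locally_finite_graph E"
    and u: "\<And>x. 0 \<le> u x"
    and super: "\<And>x. 0 \<le> (\<Sum>y\<in>nbrs E x. mu x y * Phi p (u x - u y))"
    and zero: "u z = 0"
  shows "u x = 0"
proof -
  have "(z, x) \<in> {(a, b). {a, b} \<in> E}\<^sup>*"
    using graph(2) unfolding connected_graph_def by blast
  then show ?thesis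
  proof (induction rule: rtrancl_induct)
    case (step a b)
    have fin: "finite (nbrs E a)" using graph(3) by (simp add: locally_finite_graph_def)
    have eq: "mu a y * Phi p (u a - u y) = - (mu a y * (u y powr (p - 2) * u y))" for y
      using step.IH u[of y] by (simp add: Phi_def)
    have nonneg: "0 \<le> mu a y * (u y powr (p - 2) * u y)" if "y \<in> nbrs E a" for y
      using that u[of y] weighted_graph.mu_pos[OF graph(1), of a y] by (simp add: nbrs_def)
    have "(\<Sum>y\<in>nbrs E a. mu a y * (u y powr (p - 2) * u y)) \<le> 0"
      using super[of a] by (simp add: eq sum_negf)
    moreover have "0 \<le> (\<Sum>y\<in>nbrs E a. mu a y * (u y powr (p - 2) * u y))"
      by (rule sum_nonneg) (fact nonneg)
    ultimately have "(\<Sum>y\<in>nbrs E a. mu a y * (u y powr (p - 2) * u y)) = 0" by linarith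
    then have "\<forall>y\<in>nbrs E a. mu a y * (u y powr (p - 2) * u y) = 0"
      by (subst (asm) sum_nonneg_eq_0_iff[OF fin]) (use nonneg in blast)+
    moreover have b: "b \<in> nbrs E a" using step.hyps by (simp add: nbrs_def)
    ultimately have "mu a b * (u b powr (p - 2) * u b) = 0" by blast
    moreover have "mu a b \<noteq> 0"
      using weighted_graph.mu_pos[OF graph(1), of a b] b by (simp add: nbrs_def)
    ultimately show ?case by simp
  qed (fact zero)
qed

text \<open>The existence of a positive solution makes the dyadic form of the volume integral finite.\<close>

lemma (in positive_supersolution) summable_volume:
  fixes rho :: "'v \<Rightarrow> 'v \<Rightarrow> real"
  assumes conn: "connected_graph E" and nu_pos: "\<And>x. 0 < nu x" and q: "p - 1 < q"
    and adapted: "p_adapted E mu p nu rho"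
    and complete: "Metric_space.mcomplete UNIV (path_dist E rho)"
  shows "summable (\<lambda>k. (2 ^ k) powr (p * q / (p - 1))
    / sum nu (path_ball E rho x0 (2 ^ k)) powr ((q - p + 1) / (p - 1)))"
proof -
  \<comment> \<open>Such an \<open>a\<close> exists because \<open>p - 1 < q\<close>.\<close>
  define a where "a = min (p - 1) ((q - p + 1) / (2 * (p - 1)))"
  define s where "s = max 1 (q * p / (q - (a + 1) * (p - 1)))"
  have "a * (p - 1) \<le> (q - p + 1) / (2 * (p - 1)) * (p - 1)"
    using p by (intro mult_right_mono) (auto simp: a_def)
  also have "\<dots> = (q - p + 1) / 2" using p by (simp add: divide_eq_eq)
  also have "\<dots> < q - p + 1" using q by simp
  finally have "(a + 1) * (p - 1) < q" by (simp add: distrib_right)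
  moreover have "0 < a" "a \<le> p - 1" using p q by (auto simp: a_def)
  ultimately have a: "0 < a" "a \<le> p - 1" "(a + 1) * (p - 1) < q" by blast+
  have "q * p / (q - (a + 1) * (p - 1)) \<le> s" by (simp add: s_def)
  moreover have "0 < q - (a + 1) * (p - 1)" using a by simp
  ultimately have "q * p \<le> s * (q - (a + 1) * (p - 1))" by (simp only: pos_divide_le_eq)
  moreover have "1 \<le> s" by (simp add: s_def)
  ultimately have s: "1 \<le> s" "q * p \<le> s * (q - (a + 1) * (p - 1))" by blast+
  define C where "C = 2 * s / a * (s * (1 + a)) * (2 * (s * (1 + a)) / a) powr (p - 1) + s"
  have "0 \<le> 2 * s / a * (s * (1 + a)) * (2 * (s * (1 + a)) / a) powr (p - 1)" using s a by auto
  then have C: "0 < C" using s unfolding C_def by linarith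
  define b where "b = (q - p + 1) / (p - 1)"
  have b: "0 < b" and pb: "p * (1 + b) = p * q / (p - 1)"
    using p q by (auto simp: b_def field_simps)
  have el: "edge_length E rho" using adapted by (simp add: p_adapted_def)
  interpret met: Metric_space UNIV "path_dist E rho"
    by (rule Metric_space_path_dist[OF locally_finite conn el])
  define R :: "nat \<Rightarrow> real" where "R k = 2 ^ k / 2" for k
  define S where "S k = path_ball E rho x0 (2 ^ k)" for k :: nat
  define V where "V k = sum nu (S k)" for k
  define phi where "phi k x = cutoff (R k) (path_dist E rho x0 x)" for k x
  define W where "W k x = R k powr p * descent_energy E mu p (phi k) x" for k x
  define F where "F k = (\<Sum>x\<in>S k. nu x * (u x powr q * phi k x powr s))" for k
  define A where "A k = (\<Sum>x\<in>S k. W k x * (u x powr q * phi k x powr s))" for k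
  have finS: "finite (S k)" for k
    unfolding S_def by (rule finite_path_ball[OF locally_finite conn el complete])
  have R: "0 < R k" for k by (simp add: R_def)
  have x0: "x0 \<in> S k" for k by (simp add: S_def path_ball_def path_dist_def)
  have V: "0 < V k" for k
    unfolding V_def using finS x0 nu_pos by (intro sum_pos2[of _ x0]) (auto intro: less_imp_le)
  have phi: "0 \<le> phi k x" "phi k x \<le> 1" for k x by (simp_all add: phi_def cutoff_bounds)
  have phi_supp: "phi k x = 0" if "x \<notin> S k" for k x
    using that unfolding phi_def by (intro cutoff_eq_0 R) (simp add: S_def path_ball_def R_def)
  have phi_mono: "phi j x \<le> phi k x" if "j \<le> k" for j k x
    using that unfolding phi_def by (intro cutoff_mono_radius R) (auto simp: R_def)
  have S_mono: "S j \<subseteq> S k" if "j \<le> k" for j k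
  proof -
    have "(2 :: real) ^ j \<le> 2 ^ k" using that by simp
    then show ?thesis unfolding S_def path_ball_def using order.trans by blast
  qed
  have W_nonneg: "0 \<le> W k x" for k x
    unfolding W_def using descent_energy_nonneg[OF weighted_graph_axioms] by simp
  have W_sum: "(\<Sum>k<n. W k x) \<le> nu x" for n x
    unfolding W_def phi_def R_def using p
    by (intro sum_descent_energy_cutoff_le weighted_graph_axioms locally_finite conn adapted) auto
  have W_le: "W k x \<le> nu x" for k x
  proof -
    have "W k x \<le> (\<Sum>j<Suc k. W j x)" by (intro member_le_sum W_nonneg) auto
    then show ?thesis using W_sum[of x "Suc k"] by linarith
  qed
  have F: "0 < F k" for k
    unfolding F_def
  proof (rule sum_pos2[OF finS x0])
    have "phi k x0 = 1" by (simp add: phi_def cutoff_def path_dist_def)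
    then show "0 < nu x0 * (u x0 powr q * phi k x0 powr s)"
      using nu_pos[of x0] u_pos[of x0] by simp
  qed (use nu_nonneg in auto)
  have AF: "A k \<le> F k" for k
    unfolding A_def F_def using W_le by (intro sum_mono mult_right_mono) auto
  \<comment> \<open>For \<open>j < k\<close> the cutoff \<open>phi j\<close> is dominated by \<open>phi k\<close>, and the weights \<open>W j\<close> sum up to at most \<open>nu\<close>.\<close>
  have sum_AF: "(\<Sum>j<k. A j) \<le> F k" for k
  proof -
    have "A j \<le> (\<Sum>x\<in>S k. W j x * (u x powr q * phi k x powr s))" if "j < k" for j
    proof -
      have "A j = (\<Sum>x\<in>S k. W j x * (u x powr q * phi j x powr s))"
        unfolding A_def using finS S_mono[of j k] that phi_supp
        by (intro sum.mono_neutral_left) auto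
      also have "\<dots> \<le> (\<Sum>x\<in>S k. W j x * (u x powr q * phi k x powr s))"
        using W_nonneg phi phi_mono[of j k] that s
        by (intro sum_mono mult_left_mono powr_mono2) auto
      finally show ?thesis .
    qed
    then have "(\<Sum>j<k. A j) \<le> (\<Sum>j<k. \<Sum>x\<in>S k. W j x * (u x powr q * phi k x powr s))"
      by (intro sum_mono) auto
    also have "\<dots> = (\<Sum>x\<in>S k. (\<Sum>j<k. W j x) * (u x powr q * phi k x powr s))"
      by (subst sum.swap) (simp add: sum_distrib_right)
    also have "\<dots> \<le> F k"
      unfolding F_def using W_sum by (intro sum_mono mult_right_mono) auto
    finally show ?thesis .
  qed
  define \<kappa> where "\<kappa> = (1 / (2 * C)) powr (1 + b) / 2 powr (p * (1 + b))"
  define c where "c k = (2 ^ k) powr (p * (1 + b)) / V k powr b" for k :: nat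
  have growth: "\<kappa> * c k * F k powr (1 + b) \<le> A k" for k
  proof -
    define X where "X = V k / R k powr p"
    have X: "0 < X" using V R[of k] by (simp add: X_def)
    have "R k powr p * (\<Sum>x\<in>S k. descent_energy E mu p (phi k) x) \<le> V k"
      unfolding sum_distrib_left V_def using W_le by (intro sum_mono) (simp add: W_def)
    then have le_X: "(\<Sum>x\<in>S k. descent_energy E mu p (phi k) x) \<le> X"
      using R[of k] by (simp add: X_def field_simps)
    have "F k / (2 * C) * (F k / (2 * C * X)) powr b
        \<le> (\<Sum>x\<in>S k. descent_energy E mu p (phi k) x * (u x powr q * phi k x powr s))"
      unfolding F_def C_def b_def
      by (rule cutoff_growth[OF finS _ _ _ a s le_X X]) (use phi phi_supp F[of k] in \<open>simp_all add: F_def\<close>)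
    then have "R k powr p * (F k / (2 * C) * (F k / (2 * C * X)) powr b)
        \<le> R k powr p * (\<Sum>x\<in>S k. descent_energy E mu p (phi k) x * (u x powr q * phi k x powr s))"
      by (intro mult_left_mono) auto
    also have "\<dots> = A k" by (simp add: A_def W_def sum_distrib_left mult.assoc)
    also have "R k powr p * (F k / (2 * C) * (F k / (2 * C * X)) powr b) = \<kappa> * c k * F k powr (1 + b)"
    proof -
      define i where "i = 1 / (2 * C)"
      have i: "0 < i" and F_i: "F k / (2 * C) = i * F k" using C by (simp_all add: i_def)
      have "F k / (2 * C * X) = i * F k * R k powr p / V k"
        using R[of k] by (simp add: X_def i_def)
      then have "(F k / (2 * C * X)) powr b
          = i powr b * F k powr b * R k powr (p * b) / V k powr b"
        by (simp only: powr_mult powr_divide powr_powr)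
      then have "R k powr p * (F k / (2 * C) * (F k / (2 * C * X)) powr b)
          = (i * i powr b) * (R k powr p * R k powr (p * b)) / V k powr b * (F k * F k powr b)"
        unfolding F_i by simp
      also have "R k powr p * R k powr (p * b) = (2 ^ k) powr (p * (1 + b)) / 2 powr (p * (1 + b))"
        unfolding powr_add[symmetric] by (simp add: R_def powr_divide distrib_left)
      also have "i * i powr b = i powr (1 + b)" using i by (simp add: powr_add)
      also have "F k * F k powr b = F k powr (1 + b)" using F[of k] by (simp add: powr_add)
      finally show ?thesis by (simp add: \<kappa>_def c_def i_def)
    qed
    finally show ?thesis .
  qed
  have "0 < \<kappa>" using C by (simp add: \<kappa>_def)
  moreover have "0 < c k" for k using V[of k] by (simp add: c_def)
  ultimately have "summable c"
    by (rule summable_of_superlinear_growth[OF b _ F _ growth AF sum_AF])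
  then show ?thesis unfolding c_def[abs_def] pb V_def S_def unfolding b_def .
qed

theorem theorem1p1:
  fixes E :: "'v set set"
    and mu :: "'v \<Rightarrow> 'v \<Rightarrow> real"
    and sigma nu :: "'v \<Rightarrow> real"
    and rho :: "'v \<Rightarrow> 'v \<Rightarrow> real"
    and p q :: real
    and x0 :: 'v
    and u :: "'v \<Rightarrow> real"
  assumes "infinite (UNIV :: 'v set)"
    and "weighted_graph E mu"
    and "connected_graph E"
    and "locally_finite_graph E"
    and "\<not> p_parabolic E mu p"
    and "1 < p"
    and "q > p - 1"
    and "\<And>x. sigma x > 0"
    and "\<And>x. nu x = sigma x * vertex_measure E mu x"
    and "p_adapted E mu p nu rho"
    and "Metric_space.mcomplete UNIV (path_dist E rho)"
    and "(\<integral>\<^sup>+ r\<in>{1..}. ennreal (r powr (p * q / (p - 1) - 1)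
            / set_mass nu (path_ball E rho x0 r) powr ((q - p + 1) / (p - 1))) \<partial>lborel) = \<infinity>"
    and "\<And>x. u x \<ge> 0"
    and "\<And>x. - p_Laplacian E mu p u x \<ge> sigma x * u x powr q"
  shows "\<forall>x. u x = 0"
proof (rule ccontr)
  assume "\<not> ?thesis"
  then obtain x1 where x1: "u x1 \<noteq> 0" by blast
  have measure_pos: "0 < vertex_measure E mu x" for x
    using vertex_measure_pos[OF assms(1-4)] .
  then have nu_pos: "0 < nu x" for x using assms(8,9) by simp
  have super: "nu x * u x powr q \<le> (\<Sum>y\<in>nbrs E x. mu x y * Phi p (u x - u y))" for x
  proof -
    have "nu x * u x powr q = vertex_measure E mu x * (sigma x * u x powr q)"
      by (simp add: assms(9))
    also have "\<dots> \<le> vertex_measure E mu x * - p_Laplacian E mu p u x"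
      using assms(14) measure_pos by (intro mult_left_mono) (auto intro: less_imp_le)
    also have "\<dots> = - (\<Sum>y\<in>nbrs E x. mu x y * Phi p (u y - u x))"
      using measure_pos[of x] by (simp add: p_Laplacian_def)
    also have "\<dots> = (\<Sum>y\<in>nbrs E x. mu x y * Phi p (u x - u y))"
      by (simp add: sum_negf[symmetric] Phi_def abs_minus_commute algebra_simps)
    finally show ?thesis .
  qed
  have "0 \<le> (\<Sum>y\<in>nbrs E x. mu x y * Phi p (u x - u y))" for x
    using super[of x] nu_pos[of x] by (smt (verit) mult_nonneg_nonneg powr_ge_zero)
  then have "u x \<noteq> 0" for x
    using supersolution_pos_or_zero[where u = u and E = E and mu = mu and p = p and z = x and x = x1]
      assms(2-4,13) x1 by blast
  then have u_pos: "0 < u x" for x using assms(13)[of x] by (simp add: less_le)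
  interpret weighted_graph E mu by fact
  interpret positive_supersolution E mu p q nu u
    using assms(4,6) nu_pos u_pos super by unfold_locales (auto intro: less_imp_le)
  have el: "edge_length E rho" using assms(10) by (simp add: p_adapted_def)
  have fin: "finite (path_ball E rho x0 r)" for r
    by (rule finite_path_ball[OF assms(4,3) el assms(11)])
  define V where "V r = sum nu (path_ball E rho x0 r)" for r
  have V_mass: "set_mass nu (path_ball E rho x0 r) = V r" for r
    using fin by (simp add: set_mass_def V_def)
  have "(\<integral>\<^sup>+ r\<in>{1..}. ennreal (r powr (p * q / (p - 1) - 1) / V r powr ((q - p + 1) / (p - 1))) \<partial>lborel) < \<infinity>"
  proof (rule dyadic_integral_finite)
    have "p - 1 \<le> p * q" using assms(6,7) mult_mono[of 1 p "p - 1" q] by simp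
    then show "0 \<le> p * q / (p - 1) - 1" using assms(6) by simp
    show "0 \<le> (q - p + 1) / (p - 1)" using assms(6,7) by simp
    show "0 < V r" if "1 \<le> r" for r
      unfolding V_def using fin nu_pos that
      by (intro sum_pos2[of _ x0]) (auto simp: path_ball_def path_dist_def intro: less_imp_le)
    show "V r \<le> V r'" if "1 \<le> r" "r \<le> r'" for r r'
      unfolding V_def using fin nu_pos that
      by (intro sum_mono2) (auto simp: path_ball_def intro: less_imp_le)
    show "summable (\<lambda>k. (2 ^ k) powr (p * q / (p - 1) - 1 + 1) / V (2 ^ k) powr ((q - p + 1) / (p - 1)))"
      unfolding V_def using summable_volume[OF assms(3) nu_pos assms(7,10,11)] by simp
  qed
  then show False using assms(12) by (simp add: V_mass)
qed

end
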